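(* Let $\mathcal{C}$ be a skeletally small extriangulated category with Grothendieck monoid $\mathsf{M}(\mathcal{C})$ and Grothendieck group $\mathsf{K}_0(\mathcal{C})$. Then there is a bijection between the following sets: (1) the set of dense 2-out-of-3 subcategories of $\mathcal{C}$; (2) the set of cofinal subtractive submonoids of $\mathsf{M}(\mathcal{C})$; (3) the set of subgroups $H$ of $\mathsf{K}_0(\mathcal{C})$ such that $\rho^{-1}(H)$ is cofinal in $\mathsf{M}(\mathcal{C})$, where $\rho\colon \mathsf{M}(\mathcal{C})\to\mathsf{K}_0(\mathcal{C})$ is the natural map.
   Context: An extriangulated category $\mathcal{C}=(\mathcal{C},\mathbb{E},\mathfrak{s})$ is meant in the sense of Nakaoka--Palu; a conflation $X \to Y \to Z \dashrightarrow$ is a sequence realizing some $\delta\in\mathbb{E}(Z,X)$. Subcategories are full and closed under isomorphisms. An additive subcategory $\mathcal{D}$ of $\mathcal{C}$ (one containing $0$ and closed under finite direct sums) is dense if every object of $\mathcal{C}$ is a direct summand of an object of $\mathcal{D}$, that is, for every $C\in\mathcal{C}$ there is $C'\in\mathcal{C}$ with $C\oplus C'\in\mathcal{D}$. It is a 2-out-of-3 subcategory if, for every conflation $X\to Y\to Z\dashrightarrow$ in $\mathcal{C}$, whenever two of $X,Y,Z$ belong to $\mathcal{D}$, so does the third. All monoids are commutative, written additively. Let $\mathsf{Iso}\,\mathcal{C}$ be the set of isomorphism classes of objects. A map $f\colon\mathsf{Iso}\,\mathcal{C}\to M$ to a monoid respects conflations if $f[0]=0$ and $f[Y]=f[X]+f[Z]$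 for every conflation $X\to Y\to Z\dashrightarrow$. The Grothendieck monoid $\mathsf{M}(\mathcal{C})$ is the monoid with a map $\mathsf{Iso}\,\mathcal{C}\to\mathsf{M}(\mathcal{C})$, $X\mapsto[X]$, universal among maps to monoids respecting conflations; $\mathsf{K}_0(\mathcal{C})$ is the abelian group with the analogous universal property among abelian groups, equivalently the group completion of $\mathsf{M}(\mathcal{C})$, and $\rho$ is the group completion map $[X]\mapsto[X]$. A subset $S$ of a monoid $M$ is subtractive if $x+y\in S$ and $x\in S$ imply $y\in S$ for all $x,y\in M$; it is cofinal if for every $x\in M$ there is $y\in M$ with $x+y\in S$. *)

theory Defs
  imports "HOL-Algebra.FiniteProduct" "HOL-Library.Multiset"
begin

section \<open>Additive categories\<close>

text \<open>
  All abelian groups and commutative monoids are HOL-Algebra \<open>monoid\<close> records, so their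
  operation is written multiplicatively: \<open>\<otimes>\<close> is the sum and \<open>\<one>\<close> is zero. In particular
  \<open>\<one>\<^bsub>Mor \<C> A B\<^esub>\<close> is the zero morphism and \<open>\<one>\<^bsub>Ext \<C> Z A\<^esub>\<close> the split extension, while
  \<open>Id \<C> A\<close> is the identity morphism. Distinct hom-sets are disjoint, so that composition
  \<open>g \<cdot> f\<close> (first \<open>f\<close>, then \<open>g\<close>) needs no object arguments.
\<close>

record ('o, 'm) cat =
  Obj :: "'o set"
  Mor :: "'o \<Rightarrow> 'o \<Rightarrow> 'm monoid"
  Id  :: "'o \<Rightarrow> 'm"
  cmp :: "'m \<Rightarrow> 'm \<Rightarrow> 'm" (infixl \<open>\<cdot>\<index>\<close> 70)

definition arr :: "('o, 'm, 'z) cat_scheme \<Rightarrow> 'o \<Rightarrow> 'o \<Rightarrow> 'm set" where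
  "arr \<C> A B = carrier (Mor \<C> A B)"

locale preadditive_category =
  fixes \<C> :: "('o, 'm, 'z) cat_scheme" (structure)
  assumes arr_disjoint:
      "\<lbrakk>A \<in> Obj \<C>; B \<in> Obj \<C>; A' \<in> Obj \<C>; B' \<in> Obj \<C>; f \<in> arr \<C> A B; f \<in> arr \<C> A' B'\<rbrakk>
        \<Longrightarrow> A = A' \<and> B = B'"
    and Id_arr: "A \<in> Obj \<C> \<Longrightarrow> Id \<C> A \<in> arr \<C> A A"
    and cmp_arr:
      "\<lbrakk>A \<in> Obj \<C>; B \<in> Obj \<C>; D \<in> Obj \<C>; f \<in> arr \<C> A B; g \<in> arr \<C> B D\<rbrakk> \<Longrightarrow> g \<cdot> f \<in> arr \<C> A D"
    and cmp_Id: "\<lbrakk>A \<in> Obj \<C>; B \<in> Obj \<C>; f \<in> arr \<C> A B\<rbrakk> \<Longrightarrow> f \<cdot> Id \<C> A = f"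
    and Id_cmp: "\<lbrakk>A \<in> Obj \<C>; B \<in> Obj \<C>; f \<in> arr \<C> A B\<rbrakk> \<Longrightarrow> Id \<C> B \<cdot> f = f"
    and cmp_assoc:
      "\<lbrakk>A \<in> Obj \<C>; B \<in> Obj \<C>; D \<in> Obj \<C>; E \<in> Obj \<C>;
        f \<in> arr \<C> A B; g \<in> arr \<C> B D; h \<in> arr \<C> D E\<rbrakk> \<Longrightarrow> h \<cdot> g \<cdot> f = h \<cdot> (g \<cdot> f)"
    and Mor_group: "\<lbrakk>A \<in> Obj \<C>; B \<in> Obj \<C>\<rbrakk> \<Longrightarrow> comm_group (Mor \<C> A B)"
    and cmp_add_right:
      "\<lbrakk>A \<in> Obj \<C>; B \<in> Obj \<C>; D \<in> Obj \<C>; g \<in> arr \<C> B D\<rbrakk>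
        \<Longrightarrow> (\<lambda>f. g \<cdot> f) \<in> hom (Mor \<C> A B) (Mor \<C> A D)"
    and cmp_add_left:
      "\<lbrakk>A \<in> Obj \<C>; B \<in> Obj \<C>; D \<in> Obj \<C>; f \<in> arr \<C> A B\<rbrakk>
        \<Longrightarrow> (\<lambda>g. g \<cdot> f) \<in> hom (Mor \<C> B D) (Mor \<C> A D)"

definition zero_object :: "('o, 'm, 'z) cat_scheme \<Rightarrow> 'o \<Rightarrow> bool" where
  "zero_object \<C> Z \<longleftrightarrow> Z \<in> Obj \<C> \<and>
     (\<forall>A\<in>Obj \<C>. (\<exists>!f. f \<in> arr \<C> A Z) \<and> (\<exists>!f. f \<in> arr \<C> Z A))"

text \<open>\<open>P\<close> with injections \<open>i, j\<close> and projections \<open>p, q\<close> is a direct sum of \<open>A\<close> and \<open>B\<close>.\<close>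

definition biproduct ::
    "('o, 'm, 'z) cat_scheme \<Rightarrow> 'o \<Rightarrow> 'o \<Rightarrow> 'o \<Rightarrow> 'm \<Rightarrow> 'm \<Rightarrow> 'm \<Rightarrow> 'm \<Rightarrow> bool" where
  "biproduct \<C> A B P i j p q \<longleftrightarrow>
     A \<in> Obj \<C> \<and> B \<in> Obj \<C> \<and> P \<in> Obj \<C> \<and>
     i \<in> arr \<C> A P \<and> j \<in> arr \<C> B P \<and> p \<in> arr \<C> P A \<and> q \<in> arr \<C> P B \<and>
     p \<cdot>\<^bsub>\<C>\<^esub> i = Id \<C> A \<and> q \<cdot>\<^bsub>\<C>\<^esub> j = Id \<C> B \<and>
     p \<cdot>\<^bsub>\<C>\<^esub> j = \<one>\<^bsub>Mor \<C> B A\<^esub> \<and> q \<cdot>\<^bsub>\<C>\<^esub> i = \<one>\<^bsub>Mor \<C> A B\<^esub> \<and>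
     (i \<cdot>\<^bsub>\<C>\<^esub> p) \<otimes>\<^bsub>Mor \<C> P P\<^esub> (j \<cdot>\<^bsub>\<C>\<^esub> q) = Id \<C> P"

definition direct_sum :: "('o, 'm, 'z) cat_scheme \<Rightarrow> 'o \<Rightarrow> 'o \<Rightarrow> 'o \<Rightarrow> bool" where
  "direct_sum \<C> A B P \<longleftrightarrow> (\<exists>i j p q. biproduct \<C> A B P i j p q)"

locale additive_category = preadditive_category +
  assumes ex_zero_object: "\<exists>Z. zero_object \<C> Z"
    and ex_direct_sum: "\<lbrakk>A \<in> Obj \<C>; B \<in> Obj \<C>\<rbrakk> \<Longrightarrow> \<exists>P. direct_sum \<C> A B P"

definition iso_arr :: "('o, 'm, 'z) cat_scheme \<Rightarrow> 'o \<Rightarrow> 'o \<Rightarrow> 'm \<Rightarrow> bool" where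
  "iso_arr \<C> A B f \<longleftrightarrow> f \<in> arr \<C> A B \<and>
     (\<exists>g\<in>arr \<C> B A. g \<cdot>\<^bsub>\<C>\<^esub> f = Id \<C> A \<and> f \<cdot>\<^bsub>\<C>\<^esub> g = Id \<C> B)"

definition iso_class :: "('o, 'm, 'z) cat_scheme \<Rightarrow> 'o \<Rightarrow> 'o set" where
  "iso_class \<C> A = {B \<in> Obj \<C>. \<exists>f. iso_arr \<C> A B f}"

definition Iso :: "('o, 'm, 'z) cat_scheme \<Rightarrow> 'o set set" where
  "Iso \<C> = iso_class \<C> ` Obj \<C>"


section \<open>Extriangulated categories (Nakaoka--Palu)\<close>

text \<open>
  \<open>Ext \<C> Z A\<close> is the group \<open>\<bbbE>(Z, A)\<close>; for \<open>c : Z' \<rightarrow> Z\<close> and \<open>a : A \<rightarrow> A'\<close>, \<open>Emap \<C> c a\<close> is the map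
  \<open>\<bbbE>(c, a) : \<bbbE>(Z, A) \<rightarrow> \<bbbE>(Z', A')\<close>. \<open>Real \<C> Z A \<delta>\<close> is \<open>\<s>(\<delta>)\<close>, an equivalence class of
  sequences \<open>A \<rightarrow> B \<rightarrow> Z\<close>, each encoded as a triple \<open>(x, B, y)\<close>.
\<close>

record ('o, 'm, 'e) extri = "('o, 'm) cat" +
  Ext  :: "'o \<Rightarrow> 'o \<Rightarrow> 'e monoid"
  Emap :: "'m \<Rightarrow> 'm \<Rightarrow> 'e \<Rightarrow> 'e"
  Real :: "'o \<Rightarrow> 'o \<Rightarrow> 'e \<Rightarrow> ('m \<times> 'o \<times> 'm) set"

definition seqs :: "('o, 'm, 'z) cat_scheme \<Rightarrow> 'o \<Rightarrow> 'o \<Rightarrow> ('m \<times> 'o \<times> 'm) set" where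
  "seqs \<C> Z A = {(x, B, y). B \<in> Obj \<C> \<and> x \<in> arr \<C> A B \<and> y \<in> arr \<C> B Z}"

definition seq_equiv ::
    "('o, 'm, 'z) cat_scheme \<Rightarrow> 'o \<Rightarrow> 'o \<Rightarrow> (('m \<times> 'o \<times> 'm) \<times> ('m \<times> 'o \<times> 'm)) set" where
  "seq_equiv \<C> Z A = {((x, B, y), (x', B', y')).
     (x, B, y) \<in> seqs \<C> Z A \<and> (x', B', y') \<in> seqs \<C> Z A \<and>
     (\<exists>b. iso_arr \<C> B B' b \<and> b \<cdot>\<^bsub>\<C>\<^esub> x = x' \<and> y' \<cdot>\<^bsub>\<C>\<^esub> b = y)}"

definition push :: "('o, 'm, 'e, 'z) extri_scheme \<Rightarrow> 'o \<Rightarrow> 'm \<Rightarrow> 'e \<Rightarrow> 'e" where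
  "push \<C> Z a \<delta> = Emap \<C> (Id \<C> Z) a \<delta>"

definition pull :: "('o, 'm, 'e, 'z) extri_scheme \<Rightarrow> 'o \<Rightarrow> 'm \<Rightarrow> 'e \<Rightarrow> 'e" where
  "pull \<C> A c \<delta> = Emap \<C> c (Id \<C> A) \<delta>"

text \<open>\<open>(a, c)\<close> is a morphism of extensions from \<open>\<delta> \<in> \<bbbE>(Z, A)\<close> to \<open>\<delta>' \<in> \<bbbE>(Z', A')\<close>:
  \<open>a\<^sub>* \<delta> = c\<^sup>* \<delta>'\<close>.\<close>

definition ext_morphism ::
    "('o, 'm, 'e, 'z) extri_scheme \<Rightarrow> 'o \<Rightarrow> 'o \<Rightarrow> 'e \<Rightarrow> 'o \<Rightarrow> 'o \<Rightarrow> 'e \<Rightarrow> 'm \<Rightarrow> 'm \<Rightarrow> bool" where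
  "ext_morphism \<C> Z A \<delta> Z' A' \<delta>' a c \<longleftrightarrow>
     a \<in> arr \<C> A A' \<and> c \<in> arr \<C> Z Z' \<and> push \<C> Z a \<delta> = pull \<C> A' c \<delta>'"

definition conflation ::
    "('o, 'm, 'e, 'z) extri_scheme \<Rightarrow> 'o \<Rightarrow> 'm \<Rightarrow> 'o \<Rightarrow> 'm \<Rightarrow> 'o \<Rightarrow> 'e \<Rightarrow> bool" where
  "conflation \<C> X x Y y Z \<delta> \<longleftrightarrow>
     X \<in> Obj \<C> \<and> Z \<in> Obj \<C> \<and> \<delta> \<in> carrier (Ext \<C> Z X) \<and> (x, Y, y) \<in> Real \<C> Z X \<delta>"

text \<open>
  In \<open>real_sum\<close>, the sum of two morphisms is \<open>x \<oplus> x' = i\<^sub>B x p\<^sub>A + j\<^sub>B x' q\<^sub>A\<close> and the sum of two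
  extensions is \<open>\<delta> \<oplus> \<delta>' = \<bbbE>(p\<^sub>Z, i\<^sub>A)(\<delta>) + \<bbbE>(q\<^sub>Z, j\<^sub>A)(\<delta>')\<close>, the element of
  \<open>\<bbbE>(Z \<oplus> Z', A \<oplus> A')\<close> with components \<open>(\<delta>, 0, 0, \<delta>')\<close>. No direct sums are chosen, so
  \<open>real_split\<close> and \<open>real_sum\<close> range over all of them.
\<close>

locale extriangulated_category = additive_category \<C>
  for \<C> :: "('o, 'm, 'e, 'z) extri_scheme" (structure) +
  \<comment> \<open>(ET1) \<open>\<bbbE> : \<C>\<^sup>o\<^sup>p \<times> \<C> \<rightarrow> Ab\<close> is a biadditive functor.\<close>
  assumes Ext_group: "\<lbrakk>Z \<in> Obj \<C>; A \<in> Obj \<C>\<rbrakk> \<Longrightarrow> comm_group (Ext \<C> Z A)"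
    and Emap_hom:
      "\<lbrakk>Z \<in> Obj \<C>; Z' \<in> Obj \<C>; A \<in> Obj \<C>; A' \<in> Obj \<C>; c \<in> arr \<C> Z' Z; a \<in> arr \<C> A A'\<rbrakk>
        \<Longrightarrow> Emap \<C> c a \<in> hom (Ext \<C> Z A) (Ext \<C> Z' A')"
    and Emap_Id:
      "\<lbrakk>Z \<in> Obj \<C>; A \<in> Obj \<C>; \<delta> \<in> carrier (Ext \<C> Z A)\<rbrakk> \<Longrightarrow> Emap \<C> (Id \<C> Z) (Id \<C> A) \<delta> = \<delta>"
    and Emap_cmp:
      "\<lbrakk>Z \<in> Obj \<C>; Z' \<in> Obj \<C>; Z'' \<in> Obj \<C>; A \<in> Obj \<C>; A' \<in> Obj \<C>; A'' \<in> Obj \<C>;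
        c \<in> arr \<C> Z' Z; c' \<in> arr \<C> Z'' Z'; a \<in> arr \<C> A A'; a' \<in> arr \<C> A' A'';
        \<delta> \<in> carrier (Ext \<C> Z A)\<rbrakk>
        \<Longrightarrow> Emap \<C> (c \<cdot> c') (a' \<cdot> a) \<delta> = Emap \<C> c' a' (Emap \<C> c a \<delta>)"
    and Emap_add_left:
      "\<lbrakk>Z \<in> Obj \<C>; Z' \<in> Obj \<C>; A \<in> Obj \<C>; A' \<in> Obj \<C>;
        c \<in> arr \<C> Z' Z; c' \<in> arr \<C> Z' Z; a \<in> arr \<C> A A'; \<delta> \<in> carrier (Ext \<C> Z A)\<rbrakk>
        \<Longrightarrow> Emap \<C> (c \<otimes>\<^bsub>Mor \<C> Z' Z\<^esub> c') a \<delta> = Emap \<C> c a \<delta> \<otimes>\<^bsub>Ext \<C> Z' A'\<^esub> Emap \<C> c' a \<delta>"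
    and Emap_add_right:
      "\<lbrakk>Z \<in> Obj \<C>; Z' \<in> Obj \<C>; A \<in> Obj \<C>; A' \<in> Obj \<C>;
        c \<in> arr \<C> Z' Z; a \<in> arr \<C> A A'; a' \<in> arr \<C> A A'; \<delta> \<in> carrier (Ext \<C> Z A)\<rbrakk>
        \<Longrightarrow> Emap \<C> c (a \<otimes>\<^bsub>Mor \<C> A A'\<^esub> a') \<delta> = Emap \<C> c a \<delta> \<otimes>\<^bsub>Ext \<C> Z' A'\<^esub> Emap \<C> c a' \<delta>"
  \<comment> \<open>(ET2) \<open>\<s>\<close> is an additive realization of \<open>\<bbbE>\<close>.\<close>
    and Real_class:
      "\<lbrakk>Z \<in> Obj \<C>; A \<in> Obj \<C>; \<delta> \<in> carrier (Ext \<C> Z A)\<rbrakk>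
        \<Longrightarrow> Real \<C> Z A \<delta> \<in> seqs \<C> Z A // seq_equiv \<C> Z A"
    and real_morphism:
      "\<lbrakk>conflation \<C> A x B y Z \<delta>; conflation \<C> A' x' B' y' Z' \<delta>';
        ext_morphism \<C> Z A \<delta> Z' A' \<delta>' a c\<rbrakk>
        \<Longrightarrow> \<exists>b\<in>arr \<C> B B'. b \<cdot> x = x' \<cdot> a \<and> y' \<cdot> b = c \<cdot> y"
    and real_split:
      "biproduct \<C> A Z P i j p q \<Longrightarrow> (i, P, q) \<in> Real \<C> Z A \<one>\<^bsub>Ext \<C> Z A\<^esub>"
    and real_sum:
      "\<lbrakk>conflation \<C> A x B y Z \<delta>; conflation \<C> A' x' B' y' Z' \<delta>';
        biproduct \<C> A A' PA iA jA pA qA; biproduct \<C> B B' PB iB jB pB qB;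
        biproduct \<C> Z Z' PZ iZ jZ pZ qZ\<rbrakk>
        \<Longrightarrow> ((iB \<cdot> x \<cdot> pA) \<otimes>\<^bsub>Mor \<C> PA PB\<^esub> (jB \<cdot> x' \<cdot> qA), PB,
             (iZ \<cdot> y \<cdot> pB) \<otimes>\<^bsub>Mor \<C> PB PZ\<^esub> (jZ \<cdot> y' \<cdot> qB))
            \<in> Real \<C> PZ PA (Emap \<C> pZ iA \<delta> \<otimes>\<^bsub>Ext \<C> PZ PA\<^esub> Emap \<C> qZ jA \<delta>')"
  \<comment> \<open>(ET3) and its dual.\<close>
    and ET3:
      "\<lbrakk>conflation \<C> A x B y Z \<delta>; conflation \<C> A' x' B' y' Z' \<delta>';
        a \<in> arr \<C> A A'; b \<in> arr \<C> B B'; b \<cdot> x = x' \<cdot> a\<rbrakk>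
        \<Longrightarrow> \<exists>c. ext_morphism \<C> Z A \<delta> Z' A' \<delta>' a c \<and> c \<cdot> y = y' \<cdot> b"
    and ET3_op:
      "\<lbrakk>conflation \<C> A x B y Z \<delta>; conflation \<C> A' x' B' y' Z' \<delta>';
        b \<in> arr \<C> B B'; c \<in> arr \<C> Z Z'; y' \<cdot> b = c \<cdot> y\<rbrakk>
        \<Longrightarrow> \<exists>a. ext_morphism \<C> Z A \<delta> Z' A' \<delta>' a c \<and> b \<cdot> x = x' \<cdot> a"
  \<comment> \<open>(ET4) and its dual.\<close>
    and ET4:
      "\<lbrakk>conflation \<C> A f B f' D \<delta>; conflation \<C> B g G g' F \<delta>'\<rbrakk>
        \<Longrightarrow> \<exists>E\<in>Obj \<C>. \<exists>h' d e \<delta>''.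
              d \<in> arr \<C> D E \<and> e \<in> arr \<C> E F \<and>
              conflation \<C> A (g \<cdot> f) G h' E \<delta>'' \<and>
              h' \<cdot> g = d \<cdot> f' \<and> e \<cdot> h' = g' \<and>
              conflation \<C> D d E e F (push \<C> F f' \<delta>') \<and>
              pull \<C> A d \<delta>'' = \<delta> \<and>
              push \<C> E f \<delta>'' = pull \<C> B e \<delta>'"
    and ET4_op:
      "\<lbrakk>conflation \<C> D f' A f B \<delta>; conflation \<C> F g' B g G \<delta>'\<rbrakk>
        \<Longrightarrow> \<exists>E\<in>Obj \<C>. \<exists>h' d e \<delta>''.
              d \<in> arr \<C> D E \<and> e \<in> arr \<C> E F \<and>
              conflation \<C> E h' A (g \<cdot> f) G \<delta>'' \<and>
              h' \<cdot> d = f' \<and> f \<cdot> h' = g' \<cdot> e \<and>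
              conflation \<C> D d E e F (pull \<C> D g' \<delta>) \<and>
              push \<C> G e \<delta>'' = \<delta>' \<and>
              push \<C> B d \<delta> = pull \<C> E g \<delta>''"


section \<open>Dense 2-out-of-3 subcategories\<close>

text \<open>A full subcategory is given by its set of objects.\<close>

definition additive_subcat :: "('o, 'm, 'z) cat_scheme \<Rightarrow> 'o set \<Rightarrow> bool" where
  "additive_subcat \<C> \<D> \<longleftrightarrow> \<D> \<subseteq> Obj \<C> \<and>
     (\<forall>A\<in>\<D>. \<forall>B\<in>Obj \<C>. (\<exists>f. iso_arr \<C> A B f) \<longrightarrow> B \<in> \<D>) \<and>
     (\<exists>Z\<in>\<D>. zero_object \<C> Z) \<and>
     (\<forall>A\<in>\<D>. \<forall>B\<in>\<D>. \<forall>P. direct_sum \<C> A B P \<longrightarrow> P \<in> \<D>)"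

definition dense_subcat :: "('o, 'm, 'z) cat_scheme \<Rightarrow> 'o set \<Rightarrow> bool" where
  "dense_subcat \<C> \<D> \<longleftrightarrow>
     (\<forall>A\<in>Obj \<C>. \<exists>A'\<in>Obj \<C>. \<exists>P\<in>\<D>. direct_sum \<C> A A' P)"

definition two_out_of_three :: "('o, 'm, 'e, 'z) extri_scheme \<Rightarrow> 'o set \<Rightarrow> bool" where
  "two_out_of_three \<C> \<D> \<longleftrightarrow>
     (\<forall>X x Y y Z \<delta>. conflation \<C> X x Y y Z \<delta> \<longrightarrow>
        (X \<in> \<D> \<and> Y \<in> \<D> \<longrightarrow> Z \<in> \<D>) \<and>
        (X \<in> \<D> \<and> Z \<in> \<D> \<longrightarrow> Y \<in> \<D>) \<and>
        (Y \<in> \<D> \<and> Z \<in> \<D> \<longrightarrow> X \<in> \<D>))"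

definition dense_2of3_subcats :: "('o, 'm, 'e, 'z) extri_scheme \<Rightarrow> 'o set set" where
  "dense_2of3_subcats \<C> =
     {\<D>. additive_subcat \<C> \<D> \<and> dense_subcat \<C> \<D> \<and> two_out_of_three \<C> \<D>}"


section \<open>Cofinal subtractive submonoids and group completion\<close>

definition subtractive :: "('a, 'b) monoid_scheme \<Rightarrow> 'a set \<Rightarrow> bool" where
  "subtractive M S \<longleftrightarrow>
     (\<forall>x\<in>carrier M. \<forall>y\<in>carrier M. x \<otimes>\<^bsub>M\<^esub> y \<in> S \<and> x \<in> S \<longrightarrow> y \<in> S)"

definition cofinal :: "('a, 'b) monoid_scheme \<Rightarrow> 'a set \<Rightarrow> bool" where
  "cofinal M S \<longleftrightarrow> (\<forall>x\<in>carrier M. \<exists>y\<in>carrier M. x \<otimes>\<^bsub>M\<^esub> y \<in> S)"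

definition cofinal_subtractive_submonoids :: "('a, 'b) monoid_scheme \<Rightarrow> 'a set set" where
  "cofinal_subtractive_submonoids M = {S. submonoid S M \<and> subtractive M S \<and> cofinal M S}"

text \<open>Group completion of a commutative monoid: \<open>(a, b)\<close> represents the difference \<open>a - b\<close>.\<close>

definition gc_rel :: "('a, 'b) monoid_scheme \<Rightarrow> (('a \<times> 'a) \<times> ('a \<times> 'a)) set" where
  "gc_rel M = {((a, b), (c, d)).
     a \<in> carrier M \<and> b \<in> carrier M \<and> c \<in> carrier M \<and> d \<in> carrier M \<and>
     (\<exists>k\<in>carrier M. a \<otimes>\<^bsub>M\<^esub> d \<otimes>\<^bsub>M\<^esub> k = c \<otimes>\<^bsub>M\<^esub> b \<otimes>\<^bsub>M\<^esub> k)}"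

definition group_completion :: "('a, 'b) monoid_scheme \<Rightarrow> ('a \<times> 'a) set monoid" where
  "group_completion M =
     \<lparr>carrier = (carrier M \<times> carrier M) // gc_rel M,
      monoid.mult = (\<lambda>U V. \<Union>(a, b)\<in>U. \<Union>(c, d)\<in>V. gc_rel M `` {(a \<otimes>\<^bsub>M\<^esub> c, b \<otimes>\<^bsub>M\<^esub> d)}),
      one = gc_rel M `` {(\<one>\<^bsub>M\<^esub>, \<one>\<^bsub>M\<^esub>)}\<rparr>"

definition gc_map :: "('a, 'b) monoid_scheme \<Rightarrow> 'a \<Rightarrow> ('a \<times> 'a) set" where
  "gc_map M a = gc_rel M `` {(a, \<one>\<^bsub>M\<^esub>)}"


section \<open>Grothendieck monoid and Grothendieck group\<close>

definition respects_conflations ::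
    "('o, 'm, 'e, 'z) extri_scheme \<Rightarrow> ('a, 'b) monoid_scheme \<Rightarrow> ('o set \<Rightarrow> 'a) \<Rightarrow> bool" where
  "respects_conflations \<C> N f \<longleftrightarrow> f \<in> Iso \<C> \<rightarrow> carrier N \<and>
     (\<forall>Z. zero_object \<C> Z \<longrightarrow> f (iso_class \<C> Z) = \<one>\<^bsub>N\<^esub>) \<and>
     (\<forall>X x Y y Z \<delta>. conflation \<C> X x Y y Z \<delta> \<longrightarrow>
        f (iso_class \<C> Y) = f (iso_class \<C> X) \<otimes>\<^bsub>N\<^esub> f (iso_class \<C> Z))"

text \<open>
  The Grothendieck monoid is the free commutative monoid on \<open>Iso \<C>\<close>, i.e. the finite multisets
  over \<open>Iso \<C>\<close>, modulo the least congruence that identifies \<open>[0]\<close> with the empty multiset and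
  \<open>[Y]\<close> with \<open>[X] + [Z]\<close> for each conflation \<open>X \<rightarrow> Y \<rightarrow> Z\<close>. Its universal property is
  \<open>groth_monoid_universal\<close> below.
\<close>

definition free_iso :: "('o, 'm, 'z) cat_scheme \<Rightarrow> 'o set multiset set" where
  "free_iso \<C> = {m. set_mset m \<subseteq> Iso \<C>}"

inductive groth_cong ::
    "('o, 'm, 'e, 'z) extri_scheme \<Rightarrow> 'o set multiset \<Rightarrow> 'o set multiset \<Rightarrow> bool"
  for \<C> where
  zero: "zero_object \<C> Z \<Longrightarrow> groth_cong \<C> {#iso_class \<C> Z#} {#}"
| confl: "conflation \<C> X x Y y Z \<delta> \<Longrightarrow>
    groth_cong \<C> {#iso_class \<C> Y#} {#iso_class \<C> X, iso_class \<C> Z#}"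
| refl: "m \<in> free_iso \<C> \<Longrightarrow> groth_cong \<C> m m"
| sym: "groth_cong \<C> m n \<Longrightarrow> groth_cong \<C> n m"
| trans: "\<lbrakk>groth_cong \<C> l m; groth_cong \<C> m n\<rbrakk> \<Longrightarrow> groth_cong \<C> l n"
| add: "\<lbrakk>groth_cong \<C> m n; k \<in> free_iso \<C>\<rbrakk> \<Longrightarrow> groth_cong \<C> (m + k) (n + k)"

definition groth_rel ::
    "('o, 'm, 'e, 'z) extri_scheme \<Rightarrow> ('o set multiset \<times> 'o set multiset) set" where
  "groth_rel \<C> = {(m, n). groth_cong \<C> m n}"

definition groth_monoid :: "('o, 'm, 'e, 'z) extri_scheme \<Rightarrow> 'o set multiset set monoid" where
  "groth_monoid \<C> =
     \<lparr>carrier = free_iso \<C> // groth_rel \<C>,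
      monoid.mult = (\<lambda>U V. \<Union>m\<in>U. \<Union>n\<in>V. groth_rel \<C> `` {m + n}),
      one = groth_rel \<C> `` {{#}}\<rparr>"

definition groth_class ::
    "('o, 'm, 'e, 'z) extri_scheme \<Rightarrow> 'o set \<Rightarrow> 'o set multiset set" where
  "groth_class \<C> U = groth_rel \<C> `` {{#U#}}"

definition groth_group ::
    "('o, 'm, 'e, 'z) extri_scheme \<Rightarrow> ('o set multiset set \<times> 'o set multiset set) set monoid" where
  "groth_group \<C> = group_completion (groth_monoid \<C>)"

definition groth_rho ::
    "('o, 'm, 'e, 'z) extri_scheme \<Rightarrow>
      'o set multiset set \<Rightarrow> ('o set multiset set \<times> 'o set multiset set) set" where
  "groth_rho \<C> = gc_map (groth_monoid \<C>)"

definition rho_preimage ::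
    "('o, 'm, 'e, 'z) extri_scheme \<Rightarrow>
      ('o set multiset set \<times> 'o set multiset set) set set \<Rightarrow> 'o set multiset set set" where
  "rho_preimage \<C> H = {x \<in> carrier (groth_monoid \<C>). groth_rho \<C> x \<in> H}"

definition cofinal_K0_subgroups ::
    "('o, 'm, 'e, 'z) extri_scheme \<Rightarrow> ('o set multiset set \<times> 'o set multiset set) set set set" where
  "cofinal_K0_subgroups \<C> =
     {H. subgroup H (groth_group \<C>) \<and> cofinal (groth_monoid \<C>) (rho_preimage \<C> H)}"


section \<open>Universal properties\<close>

subsection \<open>Group completion\<close>

context comm_monoid
begin

lemma gc_equiv: "equiv (carrier G \<times> carrier G) (gc_rel G)"
proof (rule equivI)
  show "gc_rel G \<subseteq> (carrier G \<times> carrier G) \<times> (carrier G \<times> carrier G)"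
    by (auto simp: gc_rel_def)
  show "refl_on (carrier G \<times> carrier G) (gc_rel G)"
    by (auto simp: refl_on_def gc_rel_def)
  show "sym (gc_rel G)"
    by (auto simp: sym_def gc_rel_def) metis
  show "trans (gc_rel G)"
  proof (rule transI, clarify)
    fix a b c d e f
    assume 1: "((a, b), (c, d)) \<in> gc_rel G" and 2: "((c, d), (e, f)) \<in> gc_rel G"
    have C: "a \<in> carrier G" "b \<in> carrier G" "c \<in> carrier G" "d \<in> carrier G"
            "e \<in> carrier G" "f \<in> carrier G"
      using 1 2 by (auto simp: gc_rel_def)
    obtain k where k: "k \<in> carrier G" "a \<otimes> d \<otimes> k = c \<otimes> b \<otimes> k"
      using 1 by (auto simp: gc_rel_def)
    obtain l where l: "l \<in> carrier G" "c \<otimes> f \<otimes> l = e \<otimes> d \<otimes> l"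
      using 2 by (auto simp: gc_rel_def)
    have "a \<otimes> f \<otimes> (d \<otimes> k \<otimes> l) = (a \<otimes> d \<otimes> k) \<otimes> (f \<otimes> l)"
      using C k(1) l(1) by (simp add: m_ac)
    also have "\<dots> = (c \<otimes> f \<otimes> l) \<otimes> (b \<otimes> k)"
      unfolding k(2) using C k(1) l(1) by (simp add: m_ac)
    also have "\<dots> = e \<otimes> b \<otimes> (d \<otimes> k \<otimes> l)"
      unfolding l(2) using C k(1) l(1) by (simp add: m_ac)
    finally have "a \<otimes> f \<otimes> (d \<otimes> k \<otimes> l) = e \<otimes> b \<otimes> (d \<otimes> k \<otimes> l)" .
    then show "((a, b), (e, f)) \<in> gc_rel G"
      using C k(1) l(1) unfolding gc_rel_def by blast
  qed
qed

lemma gc_eq_iff: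
  assumes "a \<in> carrier G" "b \<in> carrier G" "c \<in> carrier G" "d \<in> carrier G"
  shows "gc_rel G `` {(a, b)} = gc_rel G `` {(c, d)} \<longleftrightarrow>
    (\<exists>k\<in>carrier G. a \<otimes> d \<otimes> k = c \<otimes> b \<otimes> k)"
proof -
  have "gc_rel G `` {(a, b)} = gc_rel G `` {(c, d)} \<longleftrightarrow> ((a, b), (c, d)) \<in> gc_rel G"
    using assms by (intro eq_equiv_class_iff[OF gc_equiv]) auto
  then show ?thesis using assms by (auto simp: gc_rel_def)
qed

lemma gc_mult:
  assumes "a \<in> carrier G" "b \<in> carrier G" "c \<in> carrier G" "d \<in> carrier G"
  shows "gc_rel G `` {(a, b)} \<otimes>\<^bsub>group_completion G\<^esub> gc_rel G `` {(c, d)}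
    = gc_rel G `` {(a \<otimes> c, b \<otimes> d)}"
proof -
  have *: "gc_rel G `` {(a' \<otimes> c', b' \<otimes> d')} = gc_rel G `` {(a \<otimes> c, b \<otimes> d)}"
    if 1: "((a, b), (a', b')) \<in> gc_rel G" and 2: "((c, d), (c', d')) \<in> gc_rel G" for a' b' c' d'
  proof -
    have C: "a' \<in> carrier G" "b' \<in> carrier G" "c' \<in> carrier G" "d' \<in> carrier G"
      using 1 2 by (auto simp: gc_rel_def)
    obtain k where k: "k \<in> carrier G" "a \<otimes> b' \<otimes> k = a' \<otimes> b \<otimes> k"
      using 1 by (auto simp: gc_rel_def)
    obtain l where l: "l \<in> carrier G" "c \<otimes> d' \<otimes> l = c' \<otimes> d \<otimes> l"
      using 2 by (auto simp: gc_rel_def)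
    have "(a' \<otimes> c') \<otimes> (b \<otimes> d) \<otimes> (k \<otimes> l) = (a' \<otimes> b \<otimes> k) \<otimes> (c' \<otimes> d \<otimes> l)"
      using assms C k(1) l(1) by (simp add: m_ac)
    also have "\<dots> = (a \<otimes> b' \<otimes> k) \<otimes> (c \<otimes> d' \<otimes> l)" using k l by simp
    also have "\<dots> = (a \<otimes> c) \<otimes> (b' \<otimes> d') \<otimes> (k \<otimes> l)"
      using assms C k(1) l(1) by (simp add: m_ac)
    finally have "(a' \<otimes> c') \<otimes> (b \<otimes> d) \<otimes> (k \<otimes> l) = (a \<otimes> c) \<otimes> (b' \<otimes> d') \<otimes> (k \<otimes> l)" .
    then show ?thesis
      using assms C k(1) l(1) by (subst gc_eq_iff) (auto intro!: bexI[of _ "k \<otimes> l"])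
  qed
  have refl: "(a, b) \<in> gc_rel G `` {(a, b)}" "(c, d) \<in> gc_rel G `` {(c, d)}"
    using assms by (auto simp: gc_rel_def)
  have "(\<Union>(c', d')\<in>gc_rel G `` {(c, d)}. gc_rel G `` {(a' \<otimes> c', b' \<otimes> d')})
      = gc_rel G `` {(a \<otimes> c, b \<otimes> d)}" if "((a, b), (a', b')) \<in> gc_rel G" for a' b'
    by (rule UN_constant_eq[OF refl(2)], clarify) (rule *[OF that])
  then have "(\<Union>(a', b')\<in>gc_rel G `` {(a, b)}. \<Union>(c', d')\<in>gc_rel G `` {(c, d)}.
      gc_rel G `` {(a' \<otimes> c', b' \<otimes> d')}) = gc_rel G `` {(a \<otimes> c, b \<otimes> d)}"
    by (intro UN_constant_eq[OF refl(1)]) blast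
  then show ?thesis
    by (simp add: group_completion_def)
qed

lemma gc_carrierE:
  assumes "U \<in> carrier (group_completion G)"
  obtains a b where "a \<in> carrier G" "b \<in> carrier G" "U = gc_rel G `` {(a, b)}"
  using assms by (auto simp: group_completion_def quotient_def)

lemma gc_carrierI:
  "\<lbrakk>a \<in> carrier G; b \<in> carrier G\<rbrakk> \<Longrightarrow> gc_rel G `` {(a, b)} \<in> carrier (group_completion G)"
  by (auto simp: group_completion_def intro: quotientI)

lemma gc_one: "\<one>\<^bsub>group_completion G\<^esub> = gc_rel G `` {(\<one>, \<one>)}"
  by (simp add: group_completion_def)

lemma group_completion_comm_group: "comm_group (group_completion G)"
proof (rule comm_groupI)
  fix U V W
  assume U: "U \<in> carrier (group_completion G)"
  then obtain a b where ab: "a \<in> carrier G" "b \<in> carrier G" "U = gc_rel G `` {(a, b)}"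
    by (rule gc_carrierE)
  show "\<one>\<^bsub>group_completion G\<^esub> \<otimes>\<^bsub>group_completion G\<^esub> U = U"
    using ab by (simp add: gc_one gc_mult)
  have "gc_rel G `` {(b, a)} \<otimes>\<^bsub>group_completion G\<^esub> U = \<one>\<^bsub>group_completion G\<^esub>"
    using ab by (auto simp: gc_one gc_mult gc_eq_iff m_ac intro!: bexI[of _ \<one>])
  then show "\<exists>V\<in>carrier (group_completion G). V \<otimes>\<^bsub>group_completion G\<^esub> U = \<one>\<^bsub>group_completion G\<^esub>"
    using ab gc_carrierI by blast
  assume V: "V \<in> carrier (group_completion G)"
  then obtain c d where cd: "c \<in> carrier G" "d \<in> carrier G" "V = gc_rel G `` {(c, d)}"
    by (rule gc_carrierE)
  show "U \<otimes>\<^bsub>group_completion G\<^esub> V \<in> carrier (group_completion G)"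
    using ab cd by (simp add: gc_mult gc_carrierI)
  show "U \<otimes>\<^bsub>group_completion G\<^esub> V = V \<otimes>\<^bsub>group_completion G\<^esub> U"
    using ab cd by (simp add: gc_mult m_comm)
  assume "W \<in> carrier (group_completion G)"
  then obtain e f where ef: "e \<in> carrier G" "f \<in> carrier G" "W = gc_rel G `` {(e, f)}"
    by (rule gc_carrierE)
  show "U \<otimes>\<^bsub>group_completion G\<^esub> V \<otimes>\<^bsub>group_completion G\<^esub> W =
      U \<otimes>\<^bsub>group_completion G\<^esub> (V \<otimes>\<^bsub>group_completion G\<^esub> W)"
    using ab cd ef by (simp add: gc_mult m_assoc)
qed (simp add: gc_one gc_carrierI)

lemma gc_map_hom: "gc_map G \<in> hom G (group_completion G)"
  by (auto simp: hom_def gc_map_def gc_mult gc_carrierI)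

lemma gc_map_one: "gc_map G \<one> = \<one>\<^bsub>group_completion G\<^esub>"
  by (simp add: gc_map_def gc_one)

lemma group_completion_universal:
  assumes "comm_group H" and h: "h \<in> hom G H" and h1: "h \<one> = \<one>\<^bsub>H\<^esub>"
  shows "\<exists>g\<in>hom (group_completion G) H. (\<forall>a\<in>carrier G. g (gc_map G a) = h a) \<and>
    (\<forall>g'\<in>hom (group_completion G) H. (\<forall>a\<in>carrier G. g' (gc_map G a) = h a) \<longrightarrow>
      (\<forall>U\<in>carrier (group_completion G). g' U = g U))"
proof -
  interpret H: comm_group H by fact
  interpret K: comm_group "group_completion G" by (rule group_completion_comm_group)
  have hc: "h a \<in> carrier H" if "a \<in> carrier G" for a using h that by (auto simp: hom_def)
  have hm: "h (a \<otimes> b) = h a \<otimes>\<^bsub>H\<^esub> h b" if "a \<in> carrier G" "b \<in> carrier G" for a b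
    using h that by (auto simp: hom_def)
  define g where "g U = (THE v. \<exists>a\<in>carrier G. \<exists>b\<in>carrier G.
    U = gc_rel G `` {(a, b)} \<and> v = h a \<otimes>\<^bsub>H\<^esub> inv\<^bsub>H\<^esub> h b)" for U
  have g: "g (gc_rel G `` {(a, b)}) = h a \<otimes>\<^bsub>H\<^esub> inv\<^bsub>H\<^esub> h b"
    if ab: "a \<in> carrier G" "b \<in> carrier G" for a b
    unfolding g_def
  proof (rule the_equality)
    show "\<exists>a'\<in>carrier G. \<exists>b'\<in>carrier G. gc_rel G `` {(a, b)} = gc_rel G `` {(a', b')} \<and>
      h a \<otimes>\<^bsub>H\<^esub> inv\<^bsub>H\<^esub> h b = h a' \<otimes>\<^bsub>H\<^esub> inv\<^bsub>H\<^esub> h b'"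
      using ab by blast
  next
    fix v
    assume "\<exists>a'\<in>carrier G. \<exists>b'\<in>carrier G. gc_rel G `` {(a, b)} = gc_rel G `` {(a', b')} \<and>
      v = h a' \<otimes>\<^bsub>H\<^esub> inv\<^bsub>H\<^esub> h b'"
    then obtain c d where cd: "c \<in> carrier G" "d \<in> carrier G"
      "gc_rel G `` {(a, b)} = gc_rel G `` {(c, d)}" "v = h c \<otimes>\<^bsub>H\<^esub> inv\<^bsub>H\<^esub> h d" by blast
    then obtain k where k: "k \<in> carrier G" "a \<otimes> d \<otimes> k = c \<otimes> b \<otimes> k"
      using ab by (auto simp: gc_eq_iff)
    then have "h a \<otimes>\<^bsub>H\<^esub> h d \<otimes>\<^bsub>H\<^esub> h k = h c \<otimes>\<^bsub>H\<^esub> h b \<otimes>\<^bsub>H\<^esub> h k"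
      using ab cd by (metis hm m_closed)
    then have eq: "h a \<otimes>\<^bsub>H\<^esub> h d = h c \<otimes>\<^bsub>H\<^esub> h b"
      using ab cd k hc by simp
    have "h c = h a \<otimes>\<^bsub>H\<^esub> h d \<otimes>\<^bsub>H\<^esub> inv\<^bsub>H\<^esub> h b"
      unfolding eq using ab cd hc by (simp add: H.m_assoc)
    then have "v = h a \<otimes>\<^bsub>H\<^esub> h d \<otimes>\<^bsub>H\<^esub> inv\<^bsub>H\<^esub> h b \<otimes>\<^bsub>H\<^esub> inv\<^bsub>H\<^esub> h d" using cd by simp
    also have "\<dots> = h a \<otimes>\<^bsub>H\<^esub> inv\<^bsub>H\<^esub> h b \<otimes>\<^bsub>H\<^esub> (h d \<otimes>\<^bsub>H\<^esub> inv\<^bsub>H\<^esub> h d)"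
      using ab cd hc by (simp add: H.m_ac del: H.r_inv H.l_inv H.Units_r_inv H.Units_l_inv)
    finally show "v = h a \<otimes>\<^bsub>H\<^esub> inv\<^bsub>H\<^esub> h b"
      using ab cd hc by simp
  qed
  have "g \<in> hom (group_completion G) H"
  proof (rule homI)
    fix U V
    assume U: "U \<in> carrier (group_completion G)"
    then obtain a b where ab: "a \<in> carrier G" "b \<in> carrier G" "U = gc_rel G `` {(a, b)}"
      by (rule gc_carrierE)
    then show "g U \<in> carrier H" by (simp add: g hc)
    assume "V \<in> carrier (group_completion G)"
    then obtain c d where cd: "c \<in> carrier G" "d \<in> carrier G" "V = gc_rel G `` {(c, d)}"
      by (rule gc_carrierE)
    show "g (U \<otimes>\<^bsub>group_completion G\<^esub> V) = g U \<otimes>\<^bsub>H\<^esub> g V"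
      using ab cd hc by (simp add: gc_mult g hm H.inv_mult H.m_ac)
  qed
  moreover have "g (gc_map G a) = h a" if "a \<in> carrier G" for a
    using that hc by (simp add: gc_map_def g h1)
  moreover have "g' U = g U"
    if g': "g' \<in> hom (group_completion G) H" "\<forall>a\<in>carrier G. g' (gc_map G a) = h a"
      and U: "U \<in> carrier (group_completion G)" for g' U
  proof -
    obtain a b where ab: "a \<in> carrier G" "b \<in> carrier G" "U = gc_rel G `` {(a, b)}"
      using U by (rule gc_carrierE)
    have "U \<otimes>\<^bsub>group_completion G\<^esub> gc_map G b = gc_map G a"
      using ab by (auto simp: gc_map_def gc_mult gc_eq_iff m_ac intro!: bexI[of _ \<one>])
    moreover have "gc_map G b \<in> carrier (group_completion G)"
      using ab by (simp add: gc_map_def gc_carrierI)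
    ultimately have "g' U \<otimes>\<^bsub>H\<^esub> h b = h a"
      using g' U ab by (metis hom_mult)
    moreover have "g' U \<in> carrier H" using g' U by (auto simp: hom_def)
    ultimately show ?thesis
      using ab hc by (metis g H.inv_solve_right)
  qed
  ultimately show ?thesis by blast
qed

end


subsection \<open>Grothendieck monoid and group\<close>

context extriangulated_category
begin

lemma conflation_Obj:
  assumes "conflation \<C> X x Y y Z \<delta>"
  shows "X \<in> Obj \<C>" "Y \<in> Obj \<C>" "Z \<in> Obj \<C>"
proof -
  have "(x, Y, y) \<in> Real \<C> Z X \<delta>" "X \<in> Obj \<C>" "Z \<in> Obj \<C>" "\<delta> \<in> carrier (Ext \<C> Z X)"
    using assms by (auto simp: conflation_def)
  moreover from this have "Real \<C> Z X \<delta> \<in> seqs \<C> Z X // seq_equiv \<C> Z X"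
    using Real_class by blast
  ultimately obtain s where "(s, (x, Y, y)) \<in> seq_equiv \<C> Z X"
    by (auto elim!: quotientE)
  then have "(x, Y, y) \<in> seqs \<C> Z X"
    by (auto simp: seq_equiv_def)
  then show "X \<in> Obj \<C>" "Y \<in> Obj \<C>" "Z \<in> Obj \<C>"
    using \<open>X \<in> Obj \<C>\<close> \<open>Z \<in> Obj \<C>\<close> by (auto simp: seqs_def)
qed

lemma groth_cong_free: "groth_cong \<C> m n \<Longrightarrow> m \<in> free_iso \<C> \<and> n \<in> free_iso \<C>"
  by (induction rule: groth_cong.induct)
    (auto simp: free_iso_def Iso_def zero_object_def dest: conflation_Obj)

lemma groth_equiv: "equiv (free_iso \<C>) (groth_rel \<C>)"
proof (rule equivI)
  show "groth_rel \<C> \<subseteq> free_iso \<C> \<times> free_iso \<C>"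
    using groth_cong_free by (auto simp: groth_rel_def)
  show "refl_on (free_iso \<C>) (groth_rel \<C>)"
    by (auto simp: refl_on_def groth_rel_def groth_cong.refl)
  show "sym (groth_rel \<C>)"
    by (auto simp: sym_def groth_rel_def groth_cong.sym)
  show "trans (groth_rel \<C>)"
    by (auto simp: trans_def groth_rel_def intro: groth_cong.trans)
qed

lemma groth_eq_iff:
  "\<lbrakk>m \<in> free_iso \<C>; n \<in> free_iso \<C>\<rbrakk> \<Longrightarrow>
    groth_rel \<C> `` {m} = groth_rel \<C> `` {n} \<longleftrightarrow> groth_cong \<C> m n"
  using eq_equiv_class_iff[OF groth_equiv] by (auto simp: groth_rel_def)

lemma free_iso_add: "\<lbrakk>m \<in> free_iso \<C>; n \<in> free_iso \<C>\<rbrakk> \<Longrightarrow> m + n \<in> free_iso \<C>"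
  by (auto simp: free_iso_def)

lemma groth_cong_add:
  assumes "groth_cong \<C> m m'" "groth_cong \<C> n n'"
  shows "groth_cong \<C> (m + n) (m' + n')"
proof -
  have "groth_cong \<C> (m + n) (m' + n)"
    using assms groth_cong_free by (blast intro: groth_cong.add)
  moreover have "groth_cong \<C> (n + m') (n' + m')"
    using assms groth_cong_free by (blast intro: groth_cong.add)
  ultimately show ?thesis by (metis add.commute groth_cong.trans)
qed

lemma groth_mult:
  assumes "m \<in> free_iso \<C>" "n \<in> free_iso \<C>"
  shows "groth_rel \<C> `` {m} \<otimes>\<^bsub>groth_monoid \<C>\<^esub> groth_rel \<C> `` {n} = groth_rel \<C> `` {m + n}"
proof -
  have *: "groth_rel \<C> `` {m' + n'} = groth_rel \<C> `` {m + n}"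
    if "m' \<in> groth_rel \<C> `` {m}" "n' \<in> groth_rel \<C> `` {n}" for m' n'
  proof -
    have "groth_cong \<C> (m + n) (m' + n')"
      using that by (intro groth_cong_add) (auto simp: groth_rel_def)
    then show ?thesis
      using groth_cong_free groth_eq_iff groth_cong.sym by blast
  qed
  have refl: "m \<in> groth_rel \<C> `` {m}" "n \<in> groth_rel \<C> `` {n}"
    using assms by (auto simp: groth_rel_def groth_cong.refl)
  have "(\<Union>n'\<in>groth_rel \<C> `` {n}. groth_rel \<C> `` {m' + n'}) = groth_rel \<C> `` {m + n}"
    if "m' \<in> groth_rel \<C> `` {m}" for m'
    using refl(2) by (rule UN_constant_eq) (intro ballI *[OF that])
  then have "(\<Union>m'\<in>groth_rel \<C> `` {m}. \<Union>n'\<in>groth_rel \<C> `` {n}. groth_rel \<C> `` {m' + n'})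
      = groth_rel \<C> `` {m + n}"
    by (intro UN_constant_eq[OF refl(1)]) blast
  then show ?thesis
    by (simp add: groth_monoid_def)
qed

lemma groth_carrierE:
  assumes "U \<in> carrier (groth_monoid \<C>)"
  obtains m where "m \<in> free_iso \<C>" "U = groth_rel \<C> `` {m}"
  using assms by (auto simp: groth_monoid_def quotient_def)

lemma groth_carrierI: "m \<in> free_iso \<C> \<Longrightarrow> groth_rel \<C> `` {m} \<in> carrier (groth_monoid \<C>)"
  by (auto simp: groth_monoid_def intro: quotientI)

lemma empty_free_iso: "{#} \<in> free_iso \<C>"
  by (simp add: free_iso_def)

lemma groth_one: "\<one>\<^bsub>groth_monoid \<C>\<^esub> = groth_rel \<C> `` {{#}}"
  by (simp add: groth_monoid_def)

lemma groth_monoid_comm_monoid: "comm_monoid (groth_monoid \<C>)"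
proof (rule comm_monoidI)
  fix U V W
  assume "U \<in> carrier (groth_monoid \<C>)"
  then obtain l where l: "l \<in> free_iso \<C>" "U = groth_rel \<C> `` {l}" by (rule groth_carrierE)
  show "\<one>\<^bsub>groth_monoid \<C>\<^esub> \<otimes>\<^bsub>groth_monoid \<C>\<^esub> U = U"
    using l by (simp add: groth_one groth_mult empty_free_iso)
  assume "V \<in> carrier (groth_monoid \<C>)"
  then obtain m where m: "m \<in> free_iso \<C>" "V = groth_rel \<C> `` {m}" by (rule groth_carrierE)
  show "U \<otimes>\<^bsub>groth_monoid \<C>\<^esub> V \<in> carrier (groth_monoid \<C>)"
    using l m by (simp add: groth_mult groth_carrierI free_iso_add)
  show "U \<otimes>\<^bsub>groth_monoid \<C>\<^esub> V = V \<otimes>\<^bsub>groth_monoid \<C>\<^esub> U"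
    using l m by (simp add: groth_mult add.commute)
  assume "W \<in> carrier (groth_monoid \<C>)"
  then obtain n where n: "n \<in> free_iso \<C>" "W = groth_rel \<C> `` {n}" by (rule groth_carrierE)
  show "U \<otimes>\<^bsub>groth_monoid \<C>\<^esub> V \<otimes>\<^bsub>groth_monoid \<C>\<^esub> W =
      U \<otimes>\<^bsub>groth_monoid \<C>\<^esub> (V \<otimes>\<^bsub>groth_monoid \<C>\<^esub> W)"
    using l m n by (simp add: groth_mult free_iso_add add.assoc)
qed (simp add: groth_one groth_carrierI empty_free_iso)

lemma single_free_iso: "U \<in> Iso \<C> \<Longrightarrow> {#U#} \<in> free_iso \<C>"
  by (simp add: free_iso_def)

lemma iso_class_Iso: "A \<in> Obj \<C> \<Longrightarrow> iso_class \<C> A \<in> Iso \<C>"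
  by (simp add: Iso_def)

lemma groth_class_respects: "respects_conflations \<C> (groth_monoid \<C>) (groth_class \<C>)"
  unfolding respects_conflations_def
proof (intro conjI allI impI)
  show "groth_class \<C> \<in> Iso \<C> \<rightarrow> carrier (groth_monoid \<C>)"
    by (auto simp: groth_class_def intro!: groth_carrierI single_free_iso)
next
  fix Z assume "zero_object \<C> Z"
  then have "groth_cong \<C> {#iso_class \<C> Z#} {#}" by (rule groth_cong.zero)
  then show "groth_class \<C> (iso_class \<C> Z) = \<one>\<^bsub>groth_monoid \<C>\<^esub>"
    using groth_cong_free by (auto simp: groth_class_def groth_one groth_eq_iff)
next
  fix X x Y y Z \<delta> assume c: "conflation \<C> X x Y y Z \<delta>"
  then have cong: "groth_cong \<C> {#iso_class \<C> Y#} {#iso_class \<C> X, iso_class \<C> Z#}"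
    by (rule groth_cong.confl)
  have X: "{#iso_class \<C> X#} \<in> free_iso \<C>" and Z: "{#iso_class \<C> Z#} \<in> free_iso \<C>"
    using conflation_Obj[OF c] by (auto intro: single_free_iso iso_class_Iso)
  show "groth_class \<C> (iso_class \<C> Y) =
      groth_class \<C> (iso_class \<C> X) \<otimes>\<^bsub>groth_monoid \<C>\<^esub> groth_class \<C> (iso_class \<C> Z)"
    using iffD2[OF groth_eq_iff cong] groth_cong_free[OF cong]
    by (simp add: groth_class_def groth_mult[OF X Z] add_mset_commute)
qed

lemma groth_monoid_universal:
  assumes "comm_monoid N" and f: "respects_conflations \<C> N f"
  shows "\<exists>h\<in>hom (groth_monoid \<C>) N. h \<one>\<^bsub>groth_monoid \<C>\<^esub> = \<one>\<^bsub>N\<^esub> \<and>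
    (\<forall>U\<in>Iso \<C>. h (groth_class \<C> U) = f U) \<and>
    (\<forall>h'\<in>hom (groth_monoid \<C>) N. h' \<one>\<^bsub>groth_monoid \<C>\<^esub> = \<one>\<^bsub>N\<^esub> \<longrightarrow>
      (\<forall>U\<in>Iso \<C>. h' (groth_class \<C> U) = f U) \<longrightarrow>
      (\<forall>W\<in>carrier (groth_monoid \<C>). h' W = h W))"
proof -
  interpret N: comm_monoid N by fact
  have fc: "f U \<in> carrier N" if "U \<in> Iso \<C>" for U
    using f that by (auto simp: respects_conflations_def)
  define ev where "ev m = finprod N (\<lambda>U. f U [^]\<^bsub>N\<^esub> count m U) (set_mset m)" for m
  have ev_superset: "ev m = finprod N (\<lambda>U. f U [^]\<^bsub>N\<^esub> count m U) S"
    if "finite S" "set_mset m \<subseteq> S" "S \<subseteq> Iso \<C>" for m S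
    unfolding ev_def using that fc
    by (intro N.finprod_mono_neutral_cong_left) (auto simp: not_in_iff subset_iff)
  have ev_carrier: "ev m \<in> carrier N" if "m \<in> free_iso \<C>" for m
    unfolding ev_def using that fc by (intro N.finprod_closed) (auto simp: free_iso_def)
  have ev_add: "ev (m + n) = ev m \<otimes>\<^bsub>N\<^esub> ev n" if "m \<in> free_iso \<C>" "n \<in> free_iso \<C>" for m n
  proof -
    define S where "S = set_mset m \<union> set_mset n"
    have S: "finite S" "S \<subseteq> Iso \<C>" using that by (auto simp: S_def free_iso_def)
    have "ev (m + n) = finprod N (\<lambda>U. f U [^]\<^bsub>N\<^esub> count (m + n) U) S"
      using S by (intro ev_superset) (auto simp: S_def)
    also have "\<dots> = finprod N (\<lambda>U. f U [^]\<^bsub>N\<^esub> count m U \<otimes>\<^bsub>N\<^esub> f U [^]\<^bsub>N\<^esub> count n U) S"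
      using S fc by (intro N.finprod_cong) (auto simp: N.nat_pow_mult subset_iff simp_implies_def)
    also have "\<dots> = finprod N (\<lambda>U. f U [^]\<^bsub>N\<^esub> count m U) S \<otimes>\<^bsub>N\<^esub>
        finprod N (\<lambda>U. f U [^]\<^bsub>N\<^esub> count n U) S"
      using S fc by (intro N.finprod_multf) auto
    also have "\<dots> = ev m \<otimes>\<^bsub>N\<^esub> ev n"
      using S ev_superset[of S m] ev_superset[of S n] by (simp add: S_def)
    finally show ?thesis .
  qed
  have ev_single: "ev {#U#} = f U" if "U \<in> Iso \<C>" for U
    using that fc by (simp add: ev_def)
  have ev_empty: "ev {#} = \<one>\<^bsub>N\<^esub>" by (simp add: ev_def)
  have ev_cong: "ev m = ev n" if "groth_cong \<C> m n" for m n
    using that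
  proof induction
    case (zero Z)
    then show ?case
      using f by (simp add: ev_single ev_empty iso_class_Iso zero_object_def respects_conflations_def)
  next
    case (confl X x Y y Z \<delta>)
    note o = conflation_Obj[OF this]
    have "ev ({#iso_class \<C> X#} + {#iso_class \<C> Z#}) = f (iso_class \<C> X) \<otimes>\<^bsub>N\<^esub> f (iso_class \<C> Z)"
      using o by (subst ev_add) (auto simp: ev_single iso_class_Iso single_free_iso)
    moreover have "f (iso_class \<C> Y) = f (iso_class \<C> X) \<otimes>\<^bsub>N\<^esub> f (iso_class \<C> Z)"
      using f confl unfolding respects_conflations_def by blast
    ultimately show ?case using o by (simp add: ev_single iso_class_Iso add_mset_commute)
  next
    case (add m n k)
    then show ?case using groth_cong_free by (simp add: ev_add)
  qed simp_all
  define h where "h W = ev (SOME m. m \<in> W)" for W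
  have h: "h (groth_rel \<C> `` {m}) = ev m" if "m \<in> free_iso \<C>" for m
  proof -
    have "m \<in> groth_rel \<C> `` {m}" using that by (simp add: groth_rel_def groth_cong.refl)
    then have "(SOME n. n \<in> groth_rel \<C> `` {m}) \<in> groth_rel \<C> `` {m}" by (rule someI)
    then show ?thesis unfolding h_def by (simp add: groth_rel_def ev_cong)
  qed
  have "h \<in> hom (groth_monoid \<C>) N"
  proof (rule homI)
    fix V W
    assume "V \<in> carrier (groth_monoid \<C>)"
    then obtain m where m: "m \<in> free_iso \<C>" "V = groth_rel \<C> `` {m}" by (rule groth_carrierE)
    then show "h V \<in> carrier N" by (simp add: h ev_carrier)
    assume "W \<in> carrier (groth_monoid \<C>)"
    then obtain n where n: "n \<in> free_iso \<C>" "W = groth_rel \<C> `` {n}" by (rule groth_carrierE)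
    show "h (V \<otimes>\<^bsub>groth_monoid \<C>\<^esub> W) = h V \<otimes>\<^bsub>N\<^esub> h W"
      using m n by (simp add: groth_mult h ev_add free_iso_add)
  qed
  moreover have "h \<one>\<^bsub>groth_monoid \<C>\<^esub> = \<one>\<^bsub>N\<^esub>"
    by (simp add: groth_one h empty_free_iso ev_empty)
  moreover have "\<forall>U\<in>Iso \<C>. h (groth_class \<C> U) = f U"
    by (simp add: groth_class_def h single_free_iso ev_single)
  moreover have "h' W = h W"
    if h': "h' \<in> hom (groth_monoid \<C>) N" "h' \<one>\<^bsub>groth_monoid \<C>\<^esub> = \<one>\<^bsub>N\<^esub>"
      "\<forall>U\<in>Iso \<C>. h' (groth_class \<C> U) = f U"
      and W: "W \<in> carrier (groth_monoid \<C>)" for h' W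
  proof -
    have "h' (groth_rel \<C> `` {m}) = ev m" if "m \<in> free_iso \<C>" for m
      using that
    proof (induction m)
      case empty
      then show ?case using h' by (simp add: groth_one ev_empty)
    next
      case (add U m)
      then have U: "U \<in> Iso \<C>" "{#U#} \<in> free_iso \<C>" and m: "m \<in> free_iso \<C>"
        by (auto simp: free_iso_def)
      have "h' (groth_rel \<C> `` {{#U#} + m}) =
          h' (groth_class \<C> U \<otimes>\<^bsub>groth_monoid \<C>\<^esub> groth_rel \<C> `` {m})"
        using U m by (simp add: groth_class_def groth_mult)
      also have "\<dots> = f U \<otimes>\<^bsub>N\<^esub> ev m"
        using h' U m add.IH by (simp add: hom_mult groth_carrierI groth_class_def)
      also have "\<dots> = ev ({#U#} + m)"
        unfolding ev_add[OF U(2) m] ev_single[OF U(1)] by simp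
      finally show ?case by simp
    qed
    then show ?thesis using W h by (auto elim!: groth_carrierE)
  qed
  ultimately show ?thesis by blast
qed

lemma groth_group_comm_group: "comm_group (groth_group \<C>)"
  unfolding groth_group_def
  by (rule comm_monoid.group_completion_comm_group[OF groth_monoid_comm_monoid])

lemma groth_rho_hom: "groth_rho \<C> \<in> hom (groth_monoid \<C>) (groth_group \<C>)"
  unfolding groth_group_def groth_rho_def
  by (rule comm_monoid.gc_map_hom[OF groth_monoid_comm_monoid])

lemma groth_group_class_respects:
  "respects_conflations \<C> (groth_group \<C>) (groth_rho \<C> \<circ> groth_class \<C>)"
proof -
  interpret comm_monoid "groth_monoid \<C>" by (rule groth_monoid_comm_monoid)
  have *: "groth_class \<C> (iso_class \<C> X) \<in> carrier (groth_monoid \<C>)" if "X \<in> Obj \<C>" for X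
    using groth_class_respects that iso_class_Iso by (auto simp: respects_conflations_def)
  show ?thesis
    unfolding respects_conflations_def
  proof (intro conjI allI impI)
    show "groth_rho \<C> \<circ> groth_class \<C> \<in> Iso \<C> \<rightarrow> carrier (groth_group \<C>)"
      using groth_class_respects groth_rho_hom by (fastforce simp: respects_conflations_def hom_def)
    show "(groth_rho \<C> \<circ> groth_class \<C>) (iso_class \<C> Z) = \<one>\<^bsub>groth_group \<C>\<^esub>"
      if "zero_object \<C> Z" for Z
      using groth_class_respects that gc_map_one
      by (simp add: respects_conflations_def groth_rho_def groth_group_def)
    show "(groth_rho \<C> \<circ> groth_class \<C>) (iso_class \<C> Y) =
        (groth_rho \<C> \<circ> groth_class \<C>) (iso_class \<C> X) \<otimes>\<^bsub>groth_group \<C>\<^esub>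
        (groth_rho \<C> \<circ> groth_class \<C>) (iso_class \<C> Z)"
      if c: "conflation \<C> X x Y y Z \<delta>" for X x Y y Z \<delta>
    proof -
      have "groth_class \<C> (iso_class \<C> Y) =
          groth_class \<C> (iso_class \<C> X) \<otimes>\<^bsub>groth_monoid \<C>\<^esub> groth_class \<C> (iso_class \<C> Z)"
        using groth_class_respects c unfolding respects_conflations_def by blast
      then show ?thesis
        using conflation_Obj[OF c] * by (simp add: hom_mult[OF groth_rho_hom])
    qed
  qed
qed

lemma groth_group_universal:
  assumes "comm_group H" and f: "respects_conflations \<C> H f"
  shows "\<exists>g\<in>hom (groth_group \<C>) H. (\<forall>U\<in>Iso \<C>. g (groth_rho \<C> (groth_class \<C> U)) = f U) \<and>
    (\<forall>g'\<in>hom (groth_group \<C>) H. (\<forall>U\<in>Iso \<C>. g' (groth_rho \<C> (groth_class \<C> U)) = f U) \<longrightarrow>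
      (\<forall>W\<in>carrier (groth_group \<C>). g' W = g W))"
proof -
  interpret M: comm_monoid "groth_monoid \<C>" by (rule groth_monoid_comm_monoid)
  interpret H: comm_group H by fact
  interpret K: comm_group "groth_group \<C>" by (rule groth_group_comm_group)
  obtain h where h: "h \<in> hom (groth_monoid \<C>) H" "h \<one>\<^bsub>groth_monoid \<C>\<^esub> = \<one>\<^bsub>H\<^esub>"
    "\<forall>U\<in>Iso \<C>. h (groth_class \<C> U) = f U"
    and h_unique: "\<And>h' W. \<lbrakk>h' \<in> hom (groth_monoid \<C>) H; h' \<one>\<^bsub>groth_monoid \<C>\<^esub> = \<one>\<^bsub>H\<^esub>;
      \<forall>U\<in>Iso \<C>. h' (groth_class \<C> U) = f U; W \<in> carrier (groth_monoid \<C>)\<rbrakk> \<Longrightarrow> h' W = h W"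
    using groth_monoid_universal[OF H.comm_monoid_axioms f] by blast
  obtain g where g: "g \<in> hom (groth_group \<C>) H"
    "\<And>a. a \<in> carrier (groth_monoid \<C>) \<Longrightarrow> g (groth_rho \<C> a) = h a"
    and g_unique: "\<And>g' W. \<lbrakk>g' \<in> hom (groth_group \<C>) H;
      \<forall>a\<in>carrier (groth_monoid \<C>). g' (groth_rho \<C> a) = h a;
      W \<in> carrier (groth_group \<C>)\<rbrakk> \<Longrightarrow> g' W = g W"
    using M.group_completion_universal[OF \<open>comm_group H\<close> h(1,2)]
    unfolding groth_group_def groth_rho_def by blast
  have class_carrier: "groth_class \<C> U \<in> carrier (groth_monoid \<C>)" if "U \<in> Iso \<C>" for U
    using groth_class_respects that by (auto simp: respects_conflations_def)
  have "g' W = g W"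
    if g': "g' \<in> hom (groth_group \<C>) H" "\<forall>U\<in>Iso \<C>. g' (groth_rho \<C> (groth_class \<C> U)) = f U"
      and W: "W \<in> carrier (groth_group \<C>)" for g' W
  proof (rule g_unique[OF g'(1) _ W], rule ballI)
    have 1: "g' \<circ> groth_rho \<C> \<in> hom (groth_monoid \<C>) H"
      using g'(1) groth_rho_hom by (auto intro: hom_compose)
    have "g' \<one>\<^bsub>groth_group \<C>\<^esub> = \<one>\<^bsub>H\<^esub>"
      using g'(1) by (rule hom_one) (unfold_locales)
    then have 2: "(g' \<circ> groth_rho \<C>) \<one>\<^bsub>groth_monoid \<C>\<^esub> = \<one>\<^bsub>H\<^esub>"
      using M.gc_map_one by (simp add: groth_rho_def groth_group_def)
    fix a assume "a \<in> carrier (groth_monoid \<C>)"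
    then show "g' (groth_rho \<C> a) = h a"
      using h_unique[OF 1 2] g'(2) by simp
  qed
  then show ?thesis using g h(3) class_carrier by (intro bexI[of _ g]) auto
qed

end

end

theory Submission
  imports Defs "HOL-Algebra.Coset"
begin

text \<open>
  A subcategory \<open>\<D>\<close> corresponds to the set of classes \<open>[A] \<in> M(\<C>)\<close> with \<open>A \<in> \<D>\<close>, and a
  submonoid \<open>S\<close> of a monoid to the subgroup of differences of elements of \<open>S\<close>. The point that needs
  an argument is that \<open>A \<in> \<D>\<close> depends only on \<open>[A]\<close>. The isomorphism classes form a monoid under
  direct sums, in which those of \<open>\<D>\<close> are cofinal and subtractive; let \<open>H\<close> be the subgroup they
  span in its group completion \<open>K\<close>. Density and the 2-out-of-3 property make
  \<open>A \<mapsto> [A] + H \<in> K/H\<close> respect conflations, so it factors through \<open>M(\<C>)\<close>; and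
  \<open>[A] \<in> H\<close> holds precisely when \<open>A \<in> \<D>\<close>.
\<close>

section \<open>Subgroups of the group completion\<close>

text \<open>For a submonoid \<open>S\<close> this is the subgroup generated by the image of
  \<open>S\<close>, that is, the image of the group completion of \<open>S\<close> in that of
  \<open>M\<close>. It need not be the group completion of \<open>S\<close> itself.\<close>

definition gc_span :: "('a, 'b) monoid_scheme \<Rightarrow> 'a set \<Rightarrow> ('a \<times> 'a) set set" where
  "gc_span M S = {gc_rel M `` {(a, b)} | a b. a \<in> S \<and> b \<in> S}"

context comm_monoid
begin

lemma gc_inv:
  assumes "a \<in> carrier G" "b \<in> carrier G"
  shows "inv\<^bsub>group_completion G\<^esub> (gc_rel G `` {(a, b)}) = gc_rel G `` {(b, a)}"
proof -
  interpret K: comm_group "group_completion G" by (rule group_completion_comm_group)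
  have "gc_rel G `` {(b, a)} \<otimes>\<^bsub>group_completion G\<^esub> gc_rel G `` {(a, b)} = \<one>\<^bsub>group_completion G\<^esub>"
    using assms by (auto simp: gc_one gc_mult gc_eq_iff m_ac intro!: bexI[of _ \<one>])
  then show ?thesis using assms by (intro K.inv_equality) (auto simp: gc_carrierI)
qed

lemma gc_span_subgroup:
  assumes "submonoid S G"
  shows "subgroup (gc_span G S) (group_completion G)"
proof -
  interpret K: comm_group "group_completion G" by (rule group_completion_comm_group)
  interpret S: submonoid S G by fact
  show ?thesis
  proof (rule K.subgroupI)
    show "gc_span G S \<subseteq> carrier (group_completion G)"
      by (auto simp: gc_span_def intro!: gc_carrierI S.mem_carrier)
    show "gc_span G S \<noteq> {}" using S.one_closed unfolding gc_span_def by blast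
    show "inv\<^bsub>group_completion G\<^esub> U \<in> gc_span G S" if U: "U \<in> gc_span G S" for U
    proof -
      obtain a b where "a \<in> S" "b \<in> S" "U = gc_rel G `` {(a, b)}"
        using U unfolding gc_span_def by blast
      then show ?thesis using gc_inv S.mem_carrier unfolding gc_span_def by blast
    qed
    show "U \<otimes>\<^bsub>group_completion G\<^esub> V \<in> gc_span G S"
      if UV: "U \<in> gc_span G S" "V \<in> gc_span G S" for U V
    proof -
      obtain a b c d where "a \<in> S" "b \<in> S" "U = gc_rel G `` {(a, b)}"
        and "c \<in> S" "d \<in> S" "V = gc_rel G `` {(c, d)}"
        using UV unfolding gc_span_def by blast
      then show ?thesis using gc_mult S.mem_carrier S.m_closed unfolding gc_span_def by blast
    qed
  qed
qed

text \<open>The two conditions on \<open>S\<close> make it recoverable from its span. If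
  \<open>a\<close> equals \<open>c - d\<close> in the completion, then
  \<open>a + d + k = c + k\<close> for some \<open>k\<close>; cofinality replaces \<open>k\<close>
  by an element of \<open>S\<close>, and subtractivity then cancels \<open>d\<close> and this
  element.\<close>

lemma gc_map_mem_span_iff:
  assumes "S \<in> cofinal_subtractive_submonoids G" and a: "a \<in> carrier G"
  shows "gc_map G a \<in> gc_span G S \<longleftrightarrow> a \<in> S"
proof
  interpret S: submonoid S G using assms by (simp add: cofinal_subtractive_submonoids_def)
  assume "gc_map G a \<in> gc_span G S"
  then obtain c d where cd: "c \<in> S" "d \<in> S" "gc_rel G `` {(a, \<one>)} = gc_rel G `` {(c, d)}"
    by (auto simp: gc_map_def gc_span_def)
  note C = a S.mem_carrier[OF cd(1)] S.mem_carrier[OF cd(2)]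
  obtain k where k: "k \<in> carrier G" "a \<otimes> d \<otimes> k = c \<otimes> k"
    using cd C by (auto simp: gc_eq_iff)
  \<comment> \<open>The cancelling element \<open>k\<close> comes from the ambient monoid and may
    lie outside \<open>S\<close>, so it is enlarged to \<open>k \<otimes> l\<close> in
    \<open>S\<close>.\<close>
  obtain l where l: "l \<in> carrier G" "k \<otimes> l \<in> S"
    using assms k by (auto simp: cofinal_subtractive_submonoids_def cofinal_def)
  have "d \<otimes> (k \<otimes> l) \<otimes> a = (a \<otimes> d \<otimes> k) \<otimes> l" using C k(1) l by (simp add: m_ac)
  also have "\<dots> = c \<otimes> (k \<otimes> l)" unfolding k(2) using C k(1) l by (simp add: m_ac)
  finally have "d \<otimes> (k \<otimes> l) \<otimes> a \<in> S" using cd l by simp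
  moreover have "d \<otimes> (k \<otimes> l) \<in> S" using cd l by simp
  moreover have "subtractive G S" using assms by (simp add: cofinal_subtractive_submonoids_def)
  ultimately show "a \<in> S" using a S.mem_carrier unfolding subtractive_def by blast
next
  interpret S: submonoid S G using assms by (simp add: cofinal_subtractive_submonoids_def)
  show "a \<in> S \<Longrightarrow> gc_map G a \<in> gc_span G S"
    using S.one_closed unfolding gc_map_def gc_span_def by blast
qed

text \<open>The inverse takes the preimage under \<open>gc_map\<close>. Cofinality of the preimage
  ensures that every element of \<open>H\<close> is a difference of two elements of that preimage,
  so that \<open>H\<close> is spanned by it.\<close>

theorem cofinal_subtractive_bij_subgroups:
  "bij_betw (gc_span G) (cofinal_subtractive_submonoids G)
     {H. subgroup H (group_completion G) \<and> cofinal G {x \<in> carrier G. gc_map G x \<in> H}}"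
    (is "bij_betw _ ?S ?H")
proof (rule bij_betw_byWitness[where f' = "\<lambda>H. {x \<in> carrier G. gc_map G x \<in> H}"])
  interpret K: comm_group "group_completion G" by (rule group_completion_comm_group)
  have preimage_span: "{x \<in> carrier G. gc_map G x \<in> gc_span G S} = S" if "S \<in> ?S" for S
    using gc_map_mem_span_iff[OF that] that submonoid.mem_carrier
    by (fastforce simp: cofinal_subtractive_submonoids_def)
  then show "\<forall>S\<in>?S. {x \<in> carrier G. gc_map G x \<in> gc_span G S} = S" by blast
  show "gc_span G ` ?S \<subseteq> ?H"
    using preimage_span gc_span_subgroup by (auto simp: cofinal_subtractive_submonoids_def)
  have map_carrier: "gc_map G a \<in> carrier (group_completion G)" if "a \<in> carrier G" for a
    using gc_map_hom that by (auto simp: hom_def)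
  have map_mult: "gc_map G (a \<otimes> b) = gc_map G a \<otimes>\<^bsub>group_completion G\<^esub> gc_map G b"
    if "a \<in> carrier G" "b \<in> carrier G" for a b
    using gc_map_hom that by (auto simp: hom_def)
  have diff: "gc_rel G `` {(a, b)} = gc_map G a \<otimes>\<^bsub>group_completion G\<^esub> inv\<^bsub>group_completion G\<^esub> gc_map G b"
    if "a \<in> carrier G" "b \<in> carrier G" for a b
    using that by (simp add: gc_map_def gc_inv gc_mult)
  show "(\<lambda>H. {x \<in> carrier G. gc_map G x \<in> H}) ` ?H \<subseteq> ?S"
  proof (rule image_subsetI)
    fix H assume H: "H \<in> ?H"
    then interpret H: subgroup H "group_completion G" by simp
    have "y \<in> {x \<in> carrier G. gc_map G x \<in> H}"
      if xy: "x \<in> carrier G" "y \<in> carrier G" "gc_map G (x \<otimes> y) \<in> H" "gc_map G x \<in> H" for x y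
    proof -
      have "gc_map G y = inv\<^bsub>group_completion G\<^esub> gc_map G x \<otimes>\<^bsub>group_completion G\<^esub> gc_map G (x \<otimes> y)"
        using xy map_carrier by (simp add: map_mult K.inv_solve_left)
      then show ?thesis using xy by simp
    qed
    moreover have "submonoid {x \<in> carrier G. gc_map G x \<in> H} G"
      by (rule submonoid.intro) (auto simp: map_mult gc_map_one)
    ultimately show "{x \<in> carrier G. gc_map G x \<in> H} \<in> ?S"
      using H unfolding cofinal_subtractive_submonoids_def subtractive_def by blast
  qed
  show "\<forall>H\<in>?H. gc_span G {x \<in> carrier G. gc_map G x \<in> H} = H"
  proof (intro ballI subset_antisym subsetI)
    fix H U assume H: "H \<in> ?H"
    then interpret H: subgroup H "group_completion G" by simp
    show "U \<in> H" if "U \<in> gc_span G {x \<in> carrier G. gc_map G x \<in> H}"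
      using that by (auto simp: gc_span_def diff)
    assume U: "U \<in> H"
    then obtain a b where ab: "a \<in> carrier G" "b \<in> carrier G" "U = gc_rel G `` {(a, b)}"
      using H.mem_carrier by (blast elim: gc_carrierE)
    \<comment> \<open>Adding \<open>c\<close> to both entries leaves the difference \<open>U\<close>
      unchanged and puts \<open>b \<otimes> c\<close> into the preimage. As \<open>U\<close> is in
      \<open>H\<close>, the other entry \<open>a \<otimes> c\<close> then belongs to the preimage as
      well.\<close>
    obtain c where c: "c \<in> carrier G" "gc_map G (b \<otimes> c) \<in> H"
      using H ab by (auto simp: cofinal_def)
    have "U \<otimes>\<^bsub>group_completion G\<^esub> gc_map G (b \<otimes> c) = gc_map G (a \<otimes> c)"
      using ab c by (auto simp: gc_map_def gc_mult gc_eq_iff m_ac intro!: bexI[of _ \<one>])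
    then have "gc_map G (a \<otimes> c) \<in> H" using U c H.m_closed by metis
    moreover have "U = gc_rel G `` {(a \<otimes> c, b \<otimes> c)}"
      using ab c by (auto simp: gc_eq_iff m_ac intro!: bexI[of _ \<one>])
    ultimately show "U \<in> gc_span G {x \<in> carrier G. gc_map G x \<in> H}"
      using ab c unfolding gc_span_def by blast
  qed
qed

end

text \<open>Modulo \<open>H\<close> both \<open>x\<close> and \<open>y\<close> are the inverse of
  \<open>t\<close>. The form suits objects that fall into a subcategory after adding the same
  complement.\<close>

lemma (in comm_group) rcoset_eqI:
  assumes "subgroup H G" "x \<in> carrier G" "y \<in> carrier G" "t \<in> carrier G"
    and "x \<otimes> t \<in> H" "y \<otimes> t \<in> H"
  shows "H #> x = H #> y"
proof -
  interpret H: subgroup H G by fact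
  have "x \<otimes> t \<otimes> inv (y \<otimes> t) \<otimes> y = x"
  proof -
    have "x \<otimes> t \<otimes> inv (y \<otimes> t) \<otimes> y = x \<otimes> (t \<otimes> inv t) \<otimes> (y \<otimes> inv y)"
      using assms by (simp add: inv_mult m_ac del: r_inv l_inv Units_r_inv Units_l_inv)
    then show ?thesis using assms by simp
  qed
  moreover have "x \<otimes> t \<otimes> inv (y \<otimes> t) \<in> H" using assms by simp
  ultimately have "x \<in> H #> y" unfolding r_coset_def by force
  then show ?thesis using assms by (simp add: repr_independence[symmetric])
qed


section \<open>Direct sums as products\<close>

text \<open>Products only involve composition, so direct sums are compared through their universal property.\<close>

definition is_product ::
    "('o, 'm, 'z) cat_scheme \<Rightarrow> 'o \<Rightarrow> 'o \<Rightarrow> 'o \<Rightarrow> 'm \<Rightarrow> 'm \<Rightarrow> bool" where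
  "is_product \<C> A B P p q \<longleftrightarrow> A \<in> Obj \<C> \<and> B \<in> Obj \<C> \<and> P \<in> Obj \<C> \<and>
     p \<in> arr \<C> P A \<and> q \<in> arr \<C> P B \<and>
     (\<forall>X\<in>Obj \<C>. \<forall>f\<in>arr \<C> X A. \<forall>g\<in>arr \<C> X B.
        \<exists>!h. h \<in> arr \<C> X P \<and> p \<cdot>\<^bsub>\<C>\<^esub> h = f \<and> q \<cdot>\<^bsub>\<C>\<^esub> h = g)"

context preadditive_category
begin

section \<open>Arithmetic of morphisms\<close>

lemma zero_arr: "\<lbrakk>A \<in> Obj \<C>; B \<in> Obj \<C>\<rbrakk> \<Longrightarrow> \<one>\<^bsub>Mor \<C> A B\<^esub> \<in> arr \<C> A B"
  using Mor_group unfolding arr_def by (meson comm_groupE(2))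

lemma add_arr:
  "\<lbrakk>A \<in> Obj \<C>; B \<in> Obj \<C>; f \<in> arr \<C> A B; g \<in> arr \<C> A B\<rbrakk> \<Longrightarrow> f \<otimes>\<^bsub>Mor \<C> A B\<^esub> g \<in> arr \<C> A B"
  using Mor_group unfolding arr_def by (meson comm_groupE(1))

lemma add_zero:
  "\<lbrakk>A \<in> Obj \<C>; B \<in> Obj \<C>; f \<in> arr \<C> A B\<rbrakk> \<Longrightarrow> f \<otimes>\<^bsub>Mor \<C> A B\<^esub> \<one>\<^bsub>Mor \<C> A B\<^esub> = f"
  "\<lbrakk>A \<in> Obj \<C>; B \<in> Obj \<C>; f \<in> arr \<C> A B\<rbrakk> \<Longrightarrow> \<one>\<^bsub>Mor \<C> A B\<^esub> \<otimes>\<^bsub>Mor \<C> A B\<^esub> f = f"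
  using Mor_group unfolding arr_def
  by (meson comm_group_def group.is_monoid monoid.r_one monoid.l_one)+

lemma cmp_add:
  "\<lbrakk>A \<in> Obj \<C>; B \<in> Obj \<C>; D \<in> Obj \<C>; f \<in> arr \<C> A B; f' \<in> arr \<C> A B; g \<in> arr \<C> B D\<rbrakk>
    \<Longrightarrow> g \<cdot> (f \<otimes>\<^bsub>Mor \<C> A B\<^esub> f') = (g \<cdot> f) \<otimes>\<^bsub>Mor \<C> A D\<^esub> (g \<cdot> f')"
  using cmp_add_right[of A B D g] by (auto simp: hom_def arr_def)

lemma add_cmp:
  "\<lbrakk>A \<in> Obj \<C>; B \<in> Obj \<C>; D \<in> Obj \<C>; f \<in> arr \<C> A B; g \<in> arr \<C> B D; g' \<in> arr \<C> B D\<rbrakk>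
    \<Longrightarrow> (g \<otimes>\<^bsub>Mor \<C> B D\<^esub> g') \<cdot> f = (g \<cdot> f) \<otimes>\<^bsub>Mor \<C> A D\<^esub> (g' \<cdot> f)"
  using cmp_add_left[of A B D f] by (auto simp: hom_def arr_def)

lemma zero_cmp:
  assumes "A \<in> Obj \<C>" "B \<in> Obj \<C>" "D \<in> Obj \<C>" "f \<in> arr \<C> A B"
  shows "\<one>\<^bsub>Mor \<C> B D\<^esub> \<cdot> f = \<one>\<^bsub>Mor \<C> A D\<^esub>"
  using hom_one[OF cmp_add_left[OF assms]] assms Mor_group
  by (simp add: comm_group_def)

lemma is_product_unique:
  assumes "is_product \<C> A B P p q" "X \<in> Obj \<C>" "h \<in> arr \<C> X P" "k \<in> arr \<C> X P"
    "p \<cdot> h = p \<cdot> k" "q \<cdot> h = q \<cdot> k"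
  shows "h = k"
proof -
  have "p \<cdot> h \<in> arr \<C> X A" "q \<cdot> h \<in> arr \<C> X B"
    using assms by (auto simp: is_product_def intro: cmp_arr)
  then show ?thesis using assms unfolding is_product_def by metis
qed

lemma is_productE:
  assumes "is_product \<C> A B P p q" "X \<in> Obj \<C>" "f \<in> arr \<C> X A" "g \<in> arr \<C> X B"
  obtains h where "h \<in> arr \<C> X P" "p \<cdot> h = f" "q \<cdot> h = g"
  using assms unfolding is_product_def by blast

text \<open>The morphism with components \<open>f\<close> and \<open>g\<close> is
  \<open>i f + j g\<close>; the equations for \<open>p\<close> and \<open>q\<close> follow from the
  four composites of injections and projections.\<close>

lemma biproduct_is_product:
  assumes "biproduct \<C> A B P i j p q"
  shows "is_product \<C> A B P p q"
proof -
  have o: "A \<in> Obj \<C>" "B \<in> Obj \<C>" "P \<in> Obj \<C>"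
    and a: "i \<in> arr \<C> A P" "j \<in> arr \<C> B P" "p \<in> arr \<C> P A" "q \<in> arr \<C> P B"
    and e: "p \<cdot> i = Id \<C> A" "q \<cdot> j = Id \<C> B" "p \<cdot> j = \<one>\<^bsub>Mor \<C> B A\<^esub>" "q \<cdot> i = \<one>\<^bsub>Mor \<C> A B\<^esub>"
      "(i \<cdot> p) \<otimes>\<^bsub>Mor \<C> P P\<^esub> (j \<cdot> q) = Id \<C> P"
    using assms by (auto simp: biproduct_def)
  have "\<exists>!h. h \<in> arr \<C> X P \<and> p \<cdot> h = f \<and> q \<cdot> h = g"
    if X: "X \<in> Obj \<C>" and fg: "f \<in> arr \<C> X A" "g \<in> arr \<C> X B" for X f g
  proof (rule ex1I)
    let ?h = "(i \<cdot> f) \<otimes>\<^bsub>Mor \<C> X P\<^esub> (j \<cdot> g)"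
    have c: "i \<cdot> f \<in> arr \<C> X P" "j \<cdot> g \<in> arr \<C> X P" using o a X fg by (blast intro: cmp_arr)+
    have "p \<cdot> ?h = (p \<cdot> i \<cdot> f) \<otimes>\<^bsub>Mor \<C> X A\<^esub> (p \<cdot> j \<cdot> g)"
      using o a X fg c by (simp add: cmp_add[of X P A] cmp_assoc[of X A P A] cmp_assoc[of X B P A])
    also have "\<dots> = f" using o X fg by (simp add: e Id_cmp zero_cmp[of X B A] add_zero)
    finally have "p \<cdot> ?h = f" .
    moreover have "q \<cdot> ?h = (q \<cdot> i \<cdot> f) \<otimes>\<^bsub>Mor \<C> X B\<^esub> (q \<cdot> j \<cdot> g)"
      using o a X fg c by (simp add: cmp_add[of X P B] cmp_assoc[of X A P B] cmp_assoc[of X B P B])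
    moreover have "\<dots> = g" using o X fg by (simp add: e Id_cmp zero_cmp[of X A B] add_zero)
    ultimately show "?h \<in> arr \<C> X P \<and> p \<cdot> ?h = f \<and> q \<cdot> ?h = g"
      using o X c by (simp add: add_arr)
    fix h assume h: "h \<in> arr \<C> X P \<and> p \<cdot> h = f \<and> q \<cdot> h = g"
    have ip: "i \<cdot> p \<in> arr \<C> P P" "j \<cdot> q \<in> arr \<C> P P" using o a by (blast intro: cmp_arr)+
    \<comment> \<open>Uniqueness: expanding \<open>h\<close> along the decomposition of the identity
      of \<open>P\<close> expresses it through its two components.\<close>
    have "h = ((i \<cdot> p) \<otimes>\<^bsub>Mor \<C> P P\<^esub> (j \<cdot> q)) \<cdot> h" using h o X by (simp add: e Id_cmp)
    also have "\<dots> = (i \<cdot> p \<cdot> h) \<otimes>\<^bsub>Mor \<C> X P\<^esub> (j \<cdot> q \<cdot> h)"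
      using h o X ip by (simp add: add_cmp[of X P P])
    also have "\<dots> = ?h"
      using h o a X by (simp add: cmp_assoc[of X P A P] cmp_assoc[of X P B P])
    finally show "h = ?h" .
  qed
  then show ?thesis using o a by (auto simp: is_product_def)
qed

text \<open>The injections are the morphisms with components \<open>(Id, 0)\<close> and
  \<open>(0, Id)\<close>. The sum \<open>i p + j q\<close> is the identity because both have the
  same composites with the two projections.\<close>

lemma is_product_direct_sum:
  assumes "is_product \<C> A B P p q"
  shows "direct_sum \<C> A B P"
proof -
  have o: "A \<in> Obj \<C>" "B \<in> Obj \<C>" "P \<in> Obj \<C>" and a: "p \<in> arr \<C> P A" "q \<in> arr \<C> P B"
    using assms by (auto simp: is_product_def)
  obtain i where i: "i \<in> arr \<C> A P" "p \<cdot> i = Id \<C> A" "q \<cdot> i = \<one>\<^bsub>Mor \<C> A B\<^esub>"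
    using is_productE[OF assms] o Id_arr zero_arr by metis
  obtain j where j: "j \<in> arr \<C> B P" "p \<cdot> j = \<one>\<^bsub>Mor \<C> B A\<^esub>" "q \<cdot> j = Id \<C> B"
    using is_productE[OF assms] o Id_arr zero_arr by metis
  have c: "i \<cdot> p \<in> arr \<C> P P" "j \<cdot> q \<in> arr \<C> P P" using o a i j by (blast intro: cmp_arr)+
  have "p \<cdot> ((i \<cdot> p) \<otimes>\<^bsub>Mor \<C> P P\<^esub> (j \<cdot> q)) = (p \<cdot> i \<cdot> p) \<otimes>\<^bsub>Mor \<C> P A\<^esub> (p \<cdot> j \<cdot> q)"
    using o a c i(1) j(1)
    by (simp add: cmp_add[of P P A] cmp_assoc[of P A P A] cmp_assoc[of P B P A])
  also have "\<dots> = p \<cdot> Id \<C> P"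
    using o a by (simp add: i j Id_cmp cmp_Id zero_cmp[of P B A] add_zero)
  finally have 1: "p \<cdot> ((i \<cdot> p) \<otimes>\<^bsub>Mor \<C> P P\<^esub> (j \<cdot> q)) = p \<cdot> Id \<C> P" .
  have "q \<cdot> ((i \<cdot> p) \<otimes>\<^bsub>Mor \<C> P P\<^esub> (j \<cdot> q)) = (q \<cdot> i \<cdot> p) \<otimes>\<^bsub>Mor \<C> P B\<^esub> (q \<cdot> j \<cdot> q)"
    using o a c i(1) j(1)
    by (simp add: cmp_add[of P P B] cmp_assoc[of P A P B] cmp_assoc[of P B P B])
  also have "\<dots> = q \<cdot> Id \<C> P"
    using o a by (simp add: i j Id_cmp cmp_Id zero_cmp[of P A B] add_zero)
  finally have 2: "q \<cdot> ((i \<cdot> p) \<otimes>\<^bsub>Mor \<C> P P\<^esub> (j \<cdot> q)) = q \<cdot> Id \<C> P" .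
  have "(i \<cdot> p) \<otimes>\<^bsub>Mor \<C> P P\<^esub> (j \<cdot> q) = Id \<C> P"
    using is_product_unique[OF assms o(3) _ _ 1 2] o c by (simp add: add_arr Id_arr)
  then show ?thesis using o a i j unfolding direct_sum_def biproduct_def by blast
qed

lemma direct_sum_iff_product: "direct_sum \<C> A B P \<longleftrightarrow> (\<exists>p q. is_product \<C> A B P p q)"
  using biproduct_is_product is_product_direct_sum unfolding direct_sum_def by blast

lemma direct_sum_Obj: "direct_sum \<C> A B P \<Longrightarrow> A \<in> Obj \<C> \<and> B \<in> Obj \<C> \<and> P \<in> Obj \<C>"
  by (auto simp: direct_sum_def biproduct_def)

lemma direct_sum_commute: "direct_sum \<C> A B P \<Longrightarrow> direct_sum \<C> B A P"
proof -
  assume "direct_sum \<C> A B P"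
  then obtain p q where "is_product \<C> A B P p q" by (auto simp: direct_sum_iff_product)
  then have "is_product \<C> B A P q p" unfolding is_product_def by (metis (no_types, lifting))
  then show ?thesis by (auto simp: direct_sum_iff_product)
qed

text \<open>\<open>Q\<close> is a sum of \<open>A\<close> and \<open>R\<close> with projections
  \<open>p u\<close> and \<open>t\<close>, where \<open>t\<close> has components \<open>q u\<close>
  and \<open>v\<close>. A pair \<open>f\<close>, \<open>g\<close> is lifted in two stages, first to
  \<open>P\<close> using the \<open>B\<close>-component of \<open>g\<close>, then to
  \<open>Q\<close> using its \<open>D\<close>-component.\<close>

lemma direct_sum_assoc:
  assumes "direct_sum \<C> A B P" "direct_sum \<C> P D Q" "direct_sum \<C> B D R"
  shows "direct_sum \<C> A R Q"
proof -
  obtain p q where pq: "is_product \<C> A B P p q" using assms direct_sum_iff_product by blast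
  obtain u v where uv: "is_product \<C> P D Q u v" using assms direct_sum_iff_product by blast
  obtain r s where rs: "is_product \<C> B D R r s" using assms direct_sum_iff_product by blast
  have o: "A \<in> Obj \<C>" "B \<in> Obj \<C>" "P \<in> Obj \<C>" "D \<in> Obj \<C>" "Q \<in> Obj \<C>" "R \<in> Obj \<C>"
    using assms direct_sum_Obj by blast+
  have a: "p \<in> arr \<C> P A" "q \<in> arr \<C> P B" "u \<in> arr \<C> Q P" "v \<in> arr \<C> Q D"
    "r \<in> arr \<C> R B" "s \<in> arr \<C> R D"
    using pq uv rs by (auto simp: is_product_def)
  have c: "p \<cdot> u \<in> arr \<C> Q A" "q \<cdot> u \<in> arr \<C> Q B" using o a by (blast intro: cmp_arr)+
  obtain t where t: "t \<in> arr \<C> Q R" "r \<cdot> t = q \<cdot> u" "s \<cdot> t = v"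
    using is_productE[OF rs o(5) c(2) a(4)] by blast
  have rt: "r \<cdot> (t \<cdot> h) = q \<cdot> (u \<cdot> h)" "s \<cdot> (t \<cdot> h) = v \<cdot> h" "p \<cdot> u \<cdot> h = p \<cdot> (u \<cdot> h)"
    if "X \<in> Obj \<C>" "h \<in> arr \<C> X Q" for X h
    using that o a t cmp_assoc[of X Q R B h t r] cmp_assoc[of X Q R D h t s]
      cmp_assoc[of X Q P B h u q] cmp_assoc[of X Q P A h u p] by simp_all
  have "\<exists>!h. h \<in> arr \<C> X Q \<and> p \<cdot> u \<cdot> h = f \<and> t \<cdot> h = g"
    if X: "X \<in> Obj \<C>" and f: "f \<in> arr \<C> X A" and g: "g \<in> arr \<C> X R" for X f g
  proof -
    have g': "r \<cdot> g \<in> arr \<C> X B" "s \<cdot> g \<in> arr \<C> X D" using o a X g by (blast intro: cmp_arr)+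
    obtain k where k: "k \<in> arr \<C> X P" "p \<cdot> k = f" "q \<cdot> k = r \<cdot> g"
      using is_productE[OF pq X f g'(1)] by blast
    obtain h where h: "h \<in> arr \<C> X Q" "u \<cdot> h = k" "v \<cdot> h = s \<cdot> g"
      using is_productE[OF uv X k(1) g'(2)] by blast
    have "t \<cdot> h = g"
      using is_product_unique[OF rs X _ g] cmp_arr[OF X o(5,6) h(1) t(1)] rt[OF X h(1)] h k by simp
    moreover have "h' = h" if h': "h' \<in> arr \<C> X Q" "p \<cdot> u \<cdot> h' = f" "t \<cdot> h' = g" for h'
    proof (rule is_product_unique[OF uv X h'(1) h(1)])
      have "u \<cdot> h' \<in> arr \<C> X P" using o a X h' by (blast intro: cmp_arr)
      then show "u \<cdot> h' = u \<cdot> h"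
        using is_product_unique[OF pq X _ k(1)] rt[OF X h'(1)] h' k h by simp
      show "v \<cdot> h' = v \<cdot> h" using rt[OF X h'(1)] h' h by simp
    qed
    ultimately show ?thesis using h k rt[OF X h(1)] by metis
  qed
  then have "is_product \<C> A R Q (p \<cdot> u) t" using o c t by (auto simp: is_product_def)
  then show ?thesis by (auto simp: direct_sum_iff_product)
qed

section \<open>Isomorphisms, zero objects and direct sums\<close>

lemma iso_arr_refl: "A \<in> Obj \<C> \<Longrightarrow> iso_arr \<C> A A (Id \<C> A)"
  using Id_arr cmp_Id by (fastforce simp: iso_arr_def)

lemma iso_arr_sym: "iso_arr \<C> A B f \<Longrightarrow> \<exists>g. iso_arr \<C> B A g"
  by (auto simp: iso_arr_def)

lemma direct_sum_iso:
  assumes "direct_sum \<C> A B P" "direct_sum \<C> A B P'"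
  shows "\<exists>f. iso_arr \<C> P P' f"
proof -
  obtain p q where pq: "is_product \<C> A B P p q" using assms direct_sum_iff_product by blast
  obtain r s where rs: "is_product \<C> A B P' r s" using assms direct_sum_iff_product by blast
  have o: "A \<in> Obj \<C>" "B \<in> Obj \<C>" "P \<in> Obj \<C>" "P' \<in> Obj \<C>"
    using assms direct_sum_Obj by blast+
  have a: "p \<in> arr \<C> P A" "q \<in> arr \<C> P B" "r \<in> arr \<C> P' A" "s \<in> arr \<C> P' B"
    using pq rs by (auto simp: is_product_def)
  obtain f where f: "f \<in> arr \<C> P P'" "r \<cdot> f = p" "s \<cdot> f = q"
    using is_productE[OF rs o(3) a(1,2)] by blast
  obtain g where g: "g \<in> arr \<C> P' P" "p \<cdot> g = r" "q \<cdot> g = s"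
    using is_productE[OF pq o(4) a(3,4)] by blast
  have "g \<cdot> f = Id \<C> P"
  proof (rule is_product_unique[OF pq o(3)])
    show "g \<cdot> f \<in> arr \<C> P P" using o f g by (blast intro: cmp_arr)
    show "p \<cdot> (g \<cdot> f) = p \<cdot> Id \<C> P"
      using cmp_assoc[of P P' P A f g p] o a f g by (simp add: cmp_Id)
    show "q \<cdot> (g \<cdot> f) = q \<cdot> Id \<C> P"
      using cmp_assoc[of P P' P B f g q] o a f g by (simp add: cmp_Id)
  qed (use o Id_arr in auto)
  moreover have "f \<cdot> g = Id \<C> P'"
  proof (rule is_product_unique[OF rs o(4)])
    show "f \<cdot> g \<in> arr \<C> P' P'" using o f g by (blast intro: cmp_arr)
    show "r \<cdot> (f \<cdot> g) = r \<cdot> Id \<C> P'"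
      using cmp_assoc[of P' P P' A g f r] o a f g by (simp add: cmp_Id)
    show "s \<cdot> (f \<cdot> g) = s \<cdot> Id \<C> P'"
      using cmp_assoc[of P' P P' B g f s] o a f g by (simp add: cmp_Id)
  qed (use o Id_arr in auto)
  ultimately show ?thesis using f g by (auto simp: iso_arr_def)
qed

text \<open>The projection \<open>p\<close> is replaced by \<open>f \<cdot> p\<close>. Since
  \<open>f\<close> has the inverse \<open>f'\<close>, the condition \<open>f p h = g\<close> is the
  same as \<open>p h = f' g\<close>, so the old universal property applies.\<close>

lemma direct_sum_iso_left:
  assumes "direct_sum \<C> A B P" "iso_arr \<C> A A' f" "A' \<in> Obj \<C>"
  shows "direct_sum \<C> A' B P"
proof -
  obtain p q where pq: "is_product \<C> A B P p q" using assms direct_sum_iff_product by blast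
  have o: "A \<in> Obj \<C>" "B \<in> Obj \<C>" "P \<in> Obj \<C>" using assms direct_sum_Obj by blast+
  have a: "p \<in> arr \<C> P A" "q \<in> arr \<C> P B" using pq by (auto simp: is_product_def)
  obtain f' where f: "f \<in> arr \<C> A A'" "f' \<in> arr \<C> A' A" "f' \<cdot> f = Id \<C> A" "f \<cdot> f' = Id \<C> A'"
    using assms by (auto simp: iso_arr_def)
  have "\<exists>!h. h \<in> arr \<C> X P \<and> f \<cdot> p \<cdot> h = g \<and> q \<cdot> h = k"
    if X: "X \<in> Obj \<C>" and gk: "g \<in> arr \<C> X A'" "k \<in> arr \<C> X B" for X g k
  proof -
    have "f \<cdot> p \<cdot> h = g \<longleftrightarrow> p \<cdot> h = f' \<cdot> g" if h: "h \<in> arr \<C> X P" for h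
    proof -
      have ph: "p \<cdot> h \<in> arr \<C> X A" using o a X h by (blast intro: cmp_arr)
      have "f' \<cdot> (f \<cdot> (p \<cdot> h)) = p \<cdot> h"
        using cmp_assoc[of X A A' A "p \<cdot> h" f f'] o assms(3) X f ph by (simp add: Id_cmp)
      moreover have "f \<cdot> (f' \<cdot> g) = g"
        using cmp_assoc[of X A' A A' g f' f] o assms(3) X f gk by (simp add: Id_cmp)
      moreover have "f \<cdot> p \<cdot> h = f \<cdot> (p \<cdot> h)"
        using cmp_assoc[of X P A A' h p f] o assms(3) X f a h by simp
      ultimately show ?thesis by metis
    qed
    moreover have "f' \<cdot> g \<in> arr \<C> X A" using o assms(3) X f gk by (blast intro: cmp_arr)
    then have "\<exists>!h. h \<in> arr \<C> X P \<and> p \<cdot> h = f' \<cdot> g \<and> q \<cdot> h = k"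
      using pq X gk by (auto simp: is_product_def)
    ultimately show ?thesis by (metis (no_types, lifting))
  qed
  moreover have "f \<cdot> p \<in> arr \<C> P A'" using o assms(3) a f by (blast intro: cmp_arr)
  ultimately have "is_product \<C> A' B P (f \<cdot> p) q"
    using o a assms(3) by (auto simp: is_product_def)
  then show ?thesis by (auto simp: direct_sum_iff_product)
qed

lemma direct_sum_zero:
  assumes "zero_object \<C> Z" "A \<in> Obj \<C>"
  shows "direct_sum \<C> Z A A"
proof -
  obtain z where z: "z \<in> arr \<C> A Z" using assms by (auto simp: zero_object_def)
  \<comment> \<open>The second component alone determines the mediating morphism; the condition on
    the first holds automatically, as there is only one arrow into \<open>Z\<close>.\<close>
  have "is_product \<C> Z A A z (Id \<C> A)"
    unfolding is_product_def
  proof (intro conjI ballI)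
    fix X f g assume X: "X \<in> Obj \<C>" "f \<in> arr \<C> X Z" "g \<in> arr \<C> X A"
    have "z \<cdot> g \<in> arr \<C> X Z"
      using X assms z by (auto simp: zero_object_def intro: cmp_arr)
    then have "z \<cdot> g = f" using X assms by (auto simp: zero_object_def)
    then show "\<exists>!h. h \<in> arr \<C> X A \<and> z \<cdot> h = f \<and> Id \<C> A \<cdot> h = g"
      using X assms by (metis Id_cmp)
  qed (use assms z Id_arr in \<open>auto simp: zero_object_def\<close>)
  then show ?thesis by (auto simp: direct_sum_iff_product)
qed

end

context additive_category
begin

lemma direct_sum_zero_right: "\<lbrakk>zero_object \<C> Z; A \<in> Obj \<C>\<rbrakk> \<Longrightarrow> direct_sum \<C> A Z A"
  by (rule direct_sum_commute[OF direct_sum_zero])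

text \<open>An isomorphism \<open>A \<cong> B\<close> exhibits \<open>A\<close> as a direct sum of \<open>B\<close> and \<open>0\<close>.\<close>

lemma iso_arr_trans:
  assumes "iso_arr \<C> A B f" "iso_arr \<C> B D g" "A \<in> Obj \<C>" "B \<in> Obj \<C>" "D \<in> Obj \<C>"
  shows "\<exists>h. iso_arr \<C> A D h"
proof -
  obtain Z where Z: "zero_object \<C> Z" using ex_zero_object by blast
  have "direct_sum \<C> B Z A"
    using direct_sum_iso_left[OF direct_sum_zero_right[OF Z assms(3)] assms(1,4)] .
  then have "direct_sum \<C> D Z A" using direct_sum_iso_left assms(2,5) by blast
  \<comment> \<open>\<open>A\<close> and \<open>D\<close> are now both direct sums of
    \<open>D\<close> and \<open>Z\<close>, hence isomorphic.\<close>
  then show ?thesis using direct_sum_zero_right[OF Z assms(5)] by (rule direct_sum_iso)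
qed

text \<open>\<open>P'\<close> is a sum of \<open>P\<close> and \<open>0\<close>, so associativity
  makes it a sum of \<open>A\<close> and a chosen sum of \<open>B\<close> and \<open>0\<close>, for
  which \<open>B\<close> itself serves.\<close>

lemma direct_sum_iso_total:
  assumes "direct_sum \<C> A B P" "iso_arr \<C> P P' f" "P' \<in> Obj \<C>"
  shows "direct_sum \<C> A B P'"
proof -
  obtain Z where Z: "zero_object \<C> Z" using ex_zero_object by blast
  obtain g where g: "iso_arr \<C> P' P g" using iso_arr_sym[OF assms(2)] by blast
  have "direct_sum \<C> P Z P'"
    using direct_sum_iso_left[OF direct_sum_zero_right[OF Z assms(3)] g] direct_sum_Obj[OF assms(1)]
    by blast
  moreover have "direct_sum \<C> B Z B"
    using direct_sum_zero_right[OF Z] direct_sum_Obj[OF assms(1)] by blast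
  ultimately show ?thesis by (rule direct_sum_assoc[OF assms(1)])
qed

lemma iso_class_self: "A \<in> Obj \<C> \<Longrightarrow> A \<in> iso_class \<C> A"
  using iso_arr_refl by (auto simp: iso_class_def)

lemma iso_class_eqI:
  assumes "A \<in> Obj \<C>" "B \<in> Obj \<C>" "iso_arr \<C> A B f"
  shows "iso_class \<C> A = iso_class \<C> B"
proof -
  obtain g where "iso_arr \<C> B A g" using assms iso_arr_sym by blast
  then show ?thesis
    using assms iso_arr_trans unfolding iso_class_def by blast
qed

text \<open>An arrow \<open>h\<close> into \<open>B\<close> equals \<open>f (g h)\<close>, and
  \<open>g h\<close> is the only arrow into \<open>Z\<close>; arrows out of \<open>B\<close> are
  treated dually.\<close>

lemma zero_object_iso:
  assumes "zero_object \<C> Z" "iso_arr \<C> Z B f" "B \<in> Obj \<C>"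
  shows "zero_object \<C> B"
proof -
  have Z: "Z \<in> Obj \<C>" using assms by (simp add: zero_object_def)
  obtain g where fg: "f \<in> arr \<C> Z B" "g \<in> arr \<C> B Z" "f \<cdot> g = Id \<C> B"
    using assms by (auto simp: iso_arr_def)
  have "\<exists>!h. h \<in> arr \<C> A B" if A: "A \<in> Obj \<C>" for A
  proof -
    have "\<exists>!u. u \<in> arr \<C> A Z" using assms(1) A unfolding zero_object_def by blast
    then obtain u where u: "u \<in> arr \<C> A Z" "\<And>v. v \<in> arr \<C> A Z \<Longrightarrow> v = u" by auto
    have "h = f \<cdot> u" if h: "h \<in> arr \<C> A B" for h
    proof -
      have "f \<cdot> (g \<cdot> h) = h"
        using cmp_assoc[of A B Z B h g f] A Z assms(3) fg h by (simp add: Id_cmp)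
      moreover have "g \<cdot> h = u" using u(2) cmp_arr[OF A assms(3) Z h fg(2)] .
      ultimately show ?thesis by simp
    qed
    moreover have "f \<cdot> u \<in> arr \<C> A B" using cmp_arr[OF A Z assms(3) u(1) fg(1)] .
    ultimately show ?thesis by blast
  qed
  moreover have "\<exists>!h. h \<in> arr \<C> B A" if A: "A \<in> Obj \<C>" for A
  proof -
    have "\<exists>!u. u \<in> arr \<C> Z A" using assms(1) A unfolding zero_object_def by blast
    then obtain u where u: "u \<in> arr \<C> Z A" "\<And>v. v \<in> arr \<C> Z A \<Longrightarrow> v = u" by auto
    have "h = u \<cdot> g" if h: "h \<in> arr \<C> B A" for h
    proof -
      have "h \<cdot> f \<cdot> g = h"
        using cmp_assoc[of B Z B A g f h] A Z assms(3) fg h by (simp add: cmp_Id)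
      moreover have "h \<cdot> f = u" using u(2) cmp_arr[OF Z assms(3) A fg(1) h] .
      ultimately show ?thesis by simp
    qed
    moreover have "u \<cdot> g \<in> arr \<C> B A" using cmp_arr[OF assms(3) Z A fg(2) u(1)] .
    ultimately show ?thesis by blast
  qed
  ultimately show ?thesis using assms(3) by (simp add: zero_object_def)
qed

end


section \<open>The monoid of isomorphism classes under direct sums\<close>

text \<open>The group completion of this monoid is the split Grothendieck group. Taking all direct
  sums of all members avoids choosing representatives or sums; the result is again a single
  isomorphism class.\<close>

definition iso_monoid :: "('o, 'm, 'z) cat_scheme \<Rightarrow> 'o set monoid" where
  "iso_monoid \<C> = \<lparr>carrier = Iso \<C>,
     monoid.mult = (\<lambda>U V. {P. \<exists>A\<in>U. \<exists>B\<in>V. direct_sum \<C> A B P}),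
     one = {Z. zero_object \<C> Z}\<rparr>"

context additive_category
begin

text \<open>Replacing summands by isomorphic ones keeps the possible sums, sums of the same summands
  are isomorphic, and any object isomorphic to a sum is again one.\<close>

lemma iso_monoid_mult:
  assumes "direct_sum \<C> A B P"
  shows "iso_class \<C> A \<otimes>\<^bsub>iso_monoid \<C>\<^esub> iso_class \<C> B = iso_class \<C> P"
proof -
  have o: "A \<in> Obj \<C>" "B \<in> Obj \<C>" "P \<in> Obj \<C>" using direct_sum_Obj[OF assms] by auto
  have "P' \<in> iso_class \<C> P"
    if A': "A' \<in> iso_class \<C> A" and B': "B' \<in> iso_class \<C> B" and P': "direct_sum \<C> A' B' P'" for A' B' P'
  proof -
    obtain f' g' where "iso_arr \<C> A A' f'" "iso_arr \<C> B B' g'"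
      using A' B' unfolding iso_class_def by blast
    then obtain f g where "iso_arr \<C> A' A f" "iso_arr \<C> B' B g"
      using iso_arr_sym by meson
    then have "direct_sum \<C> A B P'"
      using P' o direct_sum_iso_left direct_sum_commute by meson
    then show ?thesis
      using direct_sum_iso[OF assms] direct_sum_Obj unfolding iso_class_def by blast
  qed
  moreover have "direct_sum \<C> A B P'" if "P' \<in> iso_class \<C> P" for P'
    using that direct_sum_iso_total[OF assms] by (auto simp: iso_class_def)
  moreover have "A \<in> iso_class \<C> A" "B \<in> iso_class \<C> B" using o by (simp_all add: iso_class_self)
  ultimately have "{P. \<exists>A\<in>iso_class \<C> A. \<exists>B\<in>iso_class \<C> B. direct_sum \<C> A B P} = iso_class \<C> P"
    by blast
  then show ?thesis by (simp add: iso_monoid_def)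
qed

lemma iso_monoid_one:
  assumes "zero_object \<C> Z"
  shows "\<one>\<^bsub>iso_monoid \<C>\<^esub> = iso_class \<C> Z"
proof -
  have Z: "Z \<in> Obj \<C>" using assms by (simp add: zero_object_def)
  have "Z' \<in> iso_class \<C> Z" if "zero_object \<C> Z'" for Z'
  proof -
    have Z': "Z' \<in> Obj \<C>" using that by (simp add: zero_object_def)
    \<comment> \<open>\<open>Z\<close> and \<open>Z'\<close> are both direct sums of
      \<open>Z\<close> and \<open>Z'\<close>.\<close>
    show ?thesis
      using direct_sum_iso[OF direct_sum_zero_right[OF that Z] direct_sum_zero[OF assms Z']] Z'
      unfolding iso_class_def by blast
  qed
  then show ?thesis
    using zero_object_iso[OF assms] unfolding iso_monoid_def iso_class_def by auto
qed

lemma iso_monoid_carrier: "carrier (iso_monoid \<C>) = iso_class \<C> ` Obj \<C>"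
  by (simp add: iso_monoid_def Iso_def)

lemma iso_monoid_comm_monoid: "comm_monoid (iso_monoid \<C>)"
proof -
  obtain Z where Z: "zero_object \<C> Z" using ex_zero_object by blast
  have ZO: "Z \<in> Obj \<C>" using Z by (simp add: zero_object_def)
  show ?thesis
  proof (rule comm_monoidI)
    show "\<one>\<^bsub>iso_monoid \<C>\<^esub> \<in> carrier (iso_monoid \<C>)"
      using ZO by (simp add: iso_monoid_one[OF Z] iso_monoid_carrier)
    fix U V W
    assume "U \<in> carrier (iso_monoid \<C>)"
    then obtain A where A: "A \<in> Obj \<C>" "U = iso_class \<C> A" by (auto simp: iso_monoid_carrier)
    show "\<one>\<^bsub>iso_monoid \<C>\<^esub> \<otimes>\<^bsub>iso_monoid \<C>\<^esub> U = U"
      using iso_monoid_mult[OF direct_sum_zero[OF Z A(1)]] A by (simp add: iso_monoid_one[OF Z])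
    assume "V \<in> carrier (iso_monoid \<C>)"
    then obtain B where B: "B \<in> Obj \<C>" "V = iso_class \<C> B" by (auto simp: iso_monoid_carrier)
    obtain P where P: "direct_sum \<C> A B P" using ex_direct_sum A B by blast
    have PO: "P \<in> Obj \<C>" using direct_sum_Obj[OF P] by simp
    show "U \<otimes>\<^bsub>iso_monoid \<C>\<^esub> V \<in> carrier (iso_monoid \<C>)"
      using A B PO by (simp add: iso_monoid_mult[OF P] iso_monoid_carrier)
    show "U \<otimes>\<^bsub>iso_monoid \<C>\<^esub> V = V \<otimes>\<^bsub>iso_monoid \<C>\<^esub> U"
      using A B by (simp add: iso_monoid_mult[OF P] iso_monoid_mult[OF direct_sum_commute[OF P]])
    assume "W \<in> carrier (iso_monoid \<C>)"
    then obtain D where D: "D \<in> Obj \<C>" "W = iso_class \<C> D" by (auto simp: iso_monoid_carrier)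
    obtain Q where Q: "direct_sum \<C> P D Q" using ex_direct_sum PO D by blast
    obtain R where R: "direct_sum \<C> B D R" using ex_direct_sum B D by blast
    show "U \<otimes>\<^bsub>iso_monoid \<C>\<^esub> V \<otimes>\<^bsub>iso_monoid \<C>\<^esub> W = U \<otimes>\<^bsub>iso_monoid \<C>\<^esub> (V \<otimes>\<^bsub>iso_monoid \<C>\<^esub> W)"
      using A B D by (simp add: iso_monoid_mult[OF P] iso_monoid_mult[OF Q] iso_monoid_mult[OF R]
          iso_monoid_mult[OF direct_sum_assoc[OF P Q R]])
  qed
qed

end


section \<open>Dense 2-out-of-3 subcategories and the Grothendieck monoid\<close>

context extriangulated_category
begin

text \<open>The zero extension is realized by every direct sum, so whatever holds for conflations
  applies to direct sums.\<close>

lemma direct_sum_conflation: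
  assumes "direct_sum \<C> A B P"
  obtains x y \<delta> where "conflation \<C> A x P y B \<delta>"
proof -
  obtain i j p q where b: "biproduct \<C> A B P i j p q" using assms by (auto simp: direct_sum_def)
  have o: "A \<in> Obj \<C>" "B \<in> Obj \<C>" using direct_sum_Obj[OF assms] by auto
  have "\<one>\<^bsub>Ext \<C> B A\<^esub> \<in> carrier (Ext \<C> B A)" using Ext_group o by (meson comm_groupE(2))
  then have "conflation \<C> A i P q B \<one>\<^bsub>Ext \<C> B A\<^esub>"
    using o real_split[OF b] by (simp add: conflation_def)
  then show thesis by (rule that)
qed

lemma groth_class_mult:
  assumes "conflation \<C> X x Y y Z \<delta>"
  shows "groth_class \<C> (iso_class \<C> Y) =
    groth_class \<C> (iso_class \<C> X) \<otimes>\<^bsub>groth_monoid \<C>\<^esub> groth_class \<C> (iso_class \<C> Z)"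
  using groth_class_respects assms unfolding respects_conflations_def by blast

lemma groth_class_zero: "zero_object \<C> Z \<Longrightarrow> groth_class \<C> (iso_class \<C> Z) = \<one>\<^bsub>groth_monoid \<C>\<^esub>"
  using groth_class_respects unfolding respects_conflations_def by blast

lemma groth_class_direct_sum:
  "direct_sum \<C> A B P \<Longrightarrow> groth_class \<C> (iso_class \<C> P) =
    groth_class \<C> (iso_class \<C> A) \<otimes>\<^bsub>groth_monoid \<C>\<^esub> groth_class \<C> (iso_class \<C> B)"
  by (meson direct_sum_conflation groth_class_mult)

lemma groth_class_carrier: "A \<in> Obj \<C> \<Longrightarrow> groth_class \<C> (iso_class \<C> A) \<in> carrier (groth_monoid \<C>)"
  by (simp add: groth_class_def groth_carrierI single_free_iso iso_class_Iso)

text \<open>A finite formal sum of classes is the class of one object, a direct sum of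
  representatives; the empty sum is the class of a zero object.\<close>

lemma groth_class_surj:
  assumes "W \<in> carrier (groth_monoid \<C>)"
  obtains A where "A \<in> Obj \<C>" "W = groth_class \<C> (iso_class \<C> A)"
proof -
  have "\<exists>A\<in>Obj \<C>. groth_rel \<C> `` {m} = groth_class \<C> (iso_class \<C> A)" if "m \<in> free_iso \<C>" for m
    using that
  proof (induction m)
    case empty
    obtain Z where Z: "zero_object \<C> Z" using ex_zero_object by blast
    then have "Z \<in> Obj \<C>" by (simp add: zero_object_def)
    then show ?case using groth_class_zero[OF Z] by (auto simp: groth_one)
  next
    case (add U m)
    then have m: "m \<in> free_iso \<C>" and U: "U \<in> Iso \<C>" by (auto simp: free_iso_def)
    obtain A where A: "A \<in> Obj \<C>" "groth_rel \<C> `` {m} = groth_class \<C> (iso_class \<C> A)"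
      using add m by blast
    obtain B where B: "B \<in> Obj \<C>" "U = iso_class \<C> B" using U by (auto simp: Iso_def)
    obtain P where P: "direct_sum \<C> B A P" using ex_direct_sum A B by blast
    have "groth_rel \<C> `` {{#U#} + m} = groth_class \<C> U \<otimes>\<^bsub>groth_monoid \<C>\<^esub> groth_rel \<C> `` {m}"
      using m single_free_iso[OF U] by (simp add: groth_class_def groth_mult)
    also have "\<dots> = groth_class \<C> (iso_class \<C> P)"
      using A B by (simp add: groth_class_direct_sum[OF P])
    finally show ?case using direct_sum_Obj[OF P] by auto
  qed
  then show thesis using assms that by (blast elim: groth_carrierE)
qed

text \<open>This is additivity of the realization for arbitrary direct sums; it remains to see that
  the sum extension lies in \<open>Ext \<C> PZ PA\<close>.\<close>

lemma conflation_sum: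
  assumes "conflation \<C> A x B y Z \<delta>" "conflation \<C> A' x' B' y' Z' \<delta>'"
    and "direct_sum \<C> A A' PA" "direct_sum \<C> B B' PB" "direct_sum \<C> Z Z' PZ"
  obtains x'' y'' \<delta>'' where "conflation \<C> PA x'' PB y'' PZ \<delta>''"
proof -
  obtain iA jA pA qA where A: "biproduct \<C> A A' PA iA jA pA qA"
    using assms by (auto simp: direct_sum_def)
  obtain iB jB pB qB where B: "biproduct \<C> B B' PB iB jB pB qB"
    using assms by (auto simp: direct_sum_def)
  obtain iZ jZ pZ qZ where Z: "biproduct \<C> Z Z' PZ iZ jZ pZ qZ"
    using assms by (auto simp: direct_sum_def)
  have o: "A \<in> Obj \<C>" "A' \<in> Obj \<C>" "PA \<in> Obj \<C>" "Z \<in> Obj \<C>" "Z' \<in> Obj \<C>" "PZ \<in> Obj \<C>"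
    and a: "iA \<in> arr \<C> A PA" "jA \<in> arr \<C> A' PA" "pZ \<in> arr \<C> PZ Z" "qZ \<in> arr \<C> PZ Z'"
    using A Z by (auto simp: biproduct_def)
  have d: "\<delta> \<in> carrier (Ext \<C> Z A)" "\<delta>' \<in> carrier (Ext \<C> Z' A')"
    using assms by (auto simp: conflation_def)
  have "Emap \<C> pZ iA \<delta> \<in> carrier (Ext \<C> PZ PA)" "Emap \<C> qZ jA \<delta>' \<in> carrier (Ext \<C> PZ PA)"
    using Emap_hom[of Z PZ A PA pZ iA] Emap_hom[of Z' PZ A' PA qZ jA] o a d
    by (auto simp: hom_def)
  then have "Emap \<C> pZ iA \<delta> \<otimes>\<^bsub>Ext \<C> PZ PA\<^esub> Emap \<C> qZ jA \<delta>' \<in> carrier (Ext \<C> PZ PA)"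
    using Ext_group o by (meson comm_groupE(1))
  then show thesis
    using real_sum[OF assms(1,2) A B Z] o that unfolding conflation_def by blast
qed

section \<open>Dense 2-out-of-3 subcategories modulo isomorphism\<close>

lemma dense_2of3D:
  assumes "\<D> \<in> dense_2of3_subcats \<C>"
  shows "\<D> \<subseteq> Obj \<C>"
    and "\<lbrakk>A \<in> \<D>; iso_arr \<C> A B f; B \<in> Obj \<C>\<rbrakk> \<Longrightarrow> B \<in> \<D>"
    and "\<exists>Z\<in>\<D>. zero_object \<C> Z"
    and "\<lbrakk>A \<in> \<D>; B \<in> \<D>; direct_sum \<C> A B P\<rbrakk> \<Longrightarrow> P \<in> \<D>"
    and "A \<in> Obj \<C> \<Longrightarrow> \<exists>A'\<in>Obj \<C>. \<exists>P\<in>\<D>. direct_sum \<C> A A' P"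
  using assms unfolding dense_2of3_subcats_def additive_subcat_def dense_subcat_def by blast+

lemma dense_2of3_mem_iso_class:
  assumes "\<D> \<in> dense_2of3_subcats \<C>" "A \<in> Obj \<C>"
  shows "iso_class \<C> A \<in> iso_class \<C> ` \<D> \<longleftrightarrow> A \<in> \<D>"
proof
  assume "iso_class \<C> A \<in> iso_class \<C> ` \<D>"
  then obtain B where "B \<in> \<D>" "A \<in> iso_class \<C> B" using iso_class_self[OF assms(2)] by auto
  then show "A \<in> \<D>" using dense_2of3D(2)[OF assms(1)] unfolding iso_class_def by blast
qed simp

text \<open>The split conflation from \<open>A\<close> through \<open>P\<close> to \<open>B\<close>
  has two of its terms in \<open>\<D>\<close>.\<close>

lemma dense_2of3_cancel:
  assumes "\<D> \<in> dense_2of3_subcats \<C>" "direct_sum \<C> A B P" "P \<in> \<D>" "A \<in> \<D>"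
  shows "B \<in> \<D>"
proof -
  obtain x y \<delta> where "conflation \<C> A x P y B \<delta>" using assms(2) by (rule direct_sum_conflation)
  then show ?thesis
    using assms unfolding dense_2of3_subcats_def two_out_of_three_def by blast
qed

text \<open>Density gives cofinality, and cancellation along split conflations gives subtractivity.
  Thus \<open>gc_map_mem_span_iff\<close> applies and detects membership in \<open>\<D>\<close> in
  the split Grothendieck group.\<close>

lemma dense_2of3_iso_monoid:
  assumes "\<D> \<in> dense_2of3_subcats \<C>"
  shows "iso_class \<C> ` \<D> \<in> cofinal_subtractive_submonoids (iso_monoid \<C>)"
proof -
  note D = dense_2of3D(1,4)[OF assms] and dense = dense_2of3D(5)[OF assms]
  obtain Z where Z: "Z \<in> \<D>" "zero_object \<C> Z" using dense_2of3D(3)[OF assms] by blast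
  note mem = dense_2of3_mem_iso_class[OF assms]
  have "submonoid (iso_class \<C> ` \<D>) (iso_monoid \<C>)"
  proof
    show "iso_class \<C> ` \<D> \<subseteq> carrier (iso_monoid \<C>)" using D by (auto simp: iso_monoid_carrier)
    show "\<one>\<^bsub>iso_monoid \<C>\<^esub> \<in> iso_class \<C> ` \<D>" using Z by (simp add: iso_monoid_one[OF Z(2)])
    fix U V assume "U \<in> iso_class \<C> ` \<D>" "V \<in> iso_class \<C> ` \<D>"
    then obtain A B where AB: "A \<in> \<D>" "U = iso_class \<C> A" "B \<in> \<D>" "V = iso_class \<C> B" by blast
    then obtain P where P: "direct_sum \<C> A B P" using ex_direct_sum D by blast
    then show "U \<otimes>\<^bsub>iso_monoid \<C>\<^esub> V \<in> iso_class \<C> ` \<D>"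
      using AB D(2)[OF AB(1,3) P] by (simp add: iso_monoid_mult[OF P])
  qed
  moreover have "subtractive (iso_monoid \<C>) (iso_class \<C> ` \<D>)"
    unfolding subtractive_def
  proof (intro ballI impI)
    fix U V assume UV: "U \<in> carrier (iso_monoid \<C>)" "V \<in> carrier (iso_monoid \<C>)"
      "U \<otimes>\<^bsub>iso_monoid \<C>\<^esub> V \<in> iso_class \<C> ` \<D> \<and> U \<in> iso_class \<C> ` \<D>"
    obtain A where A: "A \<in> Obj \<C>" "U = iso_class \<C> A" using UV(1) by (auto simp: iso_monoid_carrier)
    obtain B where B: "B \<in> Obj \<C>" "V = iso_class \<C> B" using UV(2) by (auto simp: iso_monoid_carrier)
    note AB = A B
    obtain P where P: "direct_sum \<C> A B P" using ex_direct_sum AB by blast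
    then have "P \<in> Obj \<C>" using direct_sum_Obj by blast
    then have "P \<in> \<D>" "A \<in> \<D>" using UV(3) AB mem by (simp_all add: iso_monoid_mult[OF P])
    then show "V \<in> iso_class \<C> ` \<D>" using dense_2of3_cancel[OF assms P] AB by simp
  qed
  moreover have "cofinal (iso_monoid \<C>) (iso_class \<C> ` \<D>)"
    unfolding cofinal_def
  proof
    fix U assume "U \<in> carrier (iso_monoid \<C>)"
    then obtain A where A: "A \<in> Obj \<C>" "U = iso_class \<C> A" by (auto simp: iso_monoid_carrier)
    then obtain A' P where P: "A' \<in> Obj \<C>" "P \<in> \<D>" "direct_sum \<C> A A' P" using dense by blast
    then show "\<exists>V\<in>carrier (iso_monoid \<C>). U \<otimes>\<^bsub>iso_monoid \<C>\<^esub> V \<in> iso_class \<C> ` \<D>"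
      using A by (intro bexI[of _ "iso_class \<C> A'"])
        (simp_all add: iso_monoid_mult[OF P(3)] iso_monoid_carrier)
  qed
  ultimately show ?thesis by (simp add: cofinal_subtractive_submonoids_def)
qed

text \<open>
  If \<open>X \<oplus> X'\<close> and \<open>Z \<oplus> Z'\<close> lie in \<open>\<D>\<close>, adding the split conflation \<open>X' \<rightarrow> X' \<oplus> Z' \<rightarrow> Z'\<close> to
  \<open>X \<rightarrow> Y \<rightarrow> Z\<close> puts \<open>Y \<oplus> X' \<oplus> Z'\<close> in \<open>\<D>\<close>; hence \<open>[Y] - [X] - [Z]\<close> vanishes modulo \<open>\<D>\<close> already
  in the split Grothendieck group.
\<close>

lemma respects_conflations_mod_dense:
  assumes "\<D> \<in> dense_2of3_subcats \<C>"
  defines "K \<equiv> group_completion (iso_monoid \<C>)"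
    and "H \<equiv> gc_span (iso_monoid \<C>) (iso_class \<C> ` \<D>)"
  shows "respects_conflations \<C> (K Mod H) (\<lambda>U. H #>\<^bsub>K\<^esub> gc_map (iso_monoid \<C>) U)"
proof -
  interpret S: comm_monoid "iso_monoid \<C>" by (rule iso_monoid_comm_monoid)
  interpret K: comm_group K unfolding K_def by (rule S.group_completion_comm_group)
  note css = dense_2of3_iso_monoid[OF assms(1)]
  have sub: "subgroup H K"
    using css S.gc_span_subgroup unfolding K_def H_def
    by (simp add: cofinal_subtractive_submonoids_def)
  interpret H: normal H K using sub by (rule K.subgroup_imp_normal)
  let ?g = "\<lambda>A. gc_map (iso_monoid \<C>) (iso_class \<C> A)"
  have carr: "iso_class \<C> A \<in> carrier (iso_monoid \<C>)" if "A \<in> Obj \<C>" for A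
    using that by (simp add: iso_monoid_carrier)
  have g_carr: "?g A \<in> carrier K" if "A \<in> Obj \<C>" for A
    using S.gc_map_hom carr[OF that] by (auto simp: hom_def K_def)
  have g_sum: "?g P = ?g A \<otimes>\<^bsub>K\<^esub> ?g B" if "direct_sum \<C> A B P" for A B P
    using hom_mult[OF S.gc_map_hom] carr direct_sum_Obj[OF that]
    by (simp add: iso_monoid_mult[OF that, symmetric] K_def)
  have g_mem: "?g A \<in> H" if "A \<in> \<D>" "A \<in> Obj \<C>" for A
    using that S.gc_map_mem_span_iff[OF css carr] by (simp add: H_def)
  show ?thesis
    unfolding respects_conflations_def
  proof (intro conjI allI impI)
    show "(\<lambda>U. H #>\<^bsub>K\<^esub> gc_map (iso_monoid \<C>) U) \<in> Iso \<C> \<rightarrow> carrier (K Mod H)"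
      using g_carr by (auto simp: Iso_def FactGroup_def RCOSETS_def)
  next
    fix Z assume "zero_object \<C> Z"
    then have "?g Z = \<one>\<^bsub>K\<^esub>" using S.gc_map_one iso_monoid_one unfolding K_def by metis
    then show "H #>\<^bsub>K\<^esub> ?g Z = \<one>\<^bsub>K Mod H\<^esub>"
      using H.subset by (simp add: FactGroup_def K.coset_mult_one)
  next
    fix X x Y y Z \<delta> assume c: "conflation \<C> X x Y y Z \<delta>"
    note o = conflation_Obj[OF c]
    note dense = dense_2of3D(5)[OF assms(1)]
    obtain X' PX where X': "X' \<in> Obj \<C>" "PX \<in> \<D>" "direct_sum \<C> X X' PX" using dense o by blast
    obtain Z' PZ where Z': "Z' \<in> Obj \<C>" "PZ \<in> \<D>" "direct_sum \<C> Z Z' PZ" using dense o by blast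
    obtain W where W: "direct_sum \<C> X' Z' W" using ex_direct_sum X' Z' by blast
    have WO: "W \<in> Obj \<C>" using direct_sum_Obj[OF W] by simp
    obtain PY where PY: "direct_sum \<C> Y W PY" using ex_direct_sum o(2) WO by blast
    obtain u v \<epsilon> where "conflation \<C> X' u W v Z' \<epsilon>" using W by (rule direct_sum_conflation)
    then obtain u' v' \<epsilon>' where "conflation \<C> PX u' PY v' PZ \<epsilon>'"
      using conflation_sum[OF c _ X'(3) PY Z'(3)] by blast
    then have PYD: "PY \<in> \<D>"
      using assms(1) X' Z' unfolding dense_2of3_subcats_def two_out_of_three_def by blast
    have PO: "PX \<in> Obj \<C>" "PY \<in> Obj \<C>" "PZ \<in> Obj \<C>"
      using direct_sum_Obj X' Z' PY by blast+
    note gc = g_carr[OF o(1)] g_carr[OF o(2)] g_carr[OF o(3)] g_carr[OF X'(1)] g_carr[OF Z'(1)]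
      g_carr[OF WO]
    \<comment> \<open>\<open>W\<close> is a common complement: the class of \<open>W\<close> added
      to that of \<open>Y\<close>, or to the sum of those of \<open>X\<close> and \<open>Z\<close>,
      gives an element of \<open>H\<close>. This is the situation of \<open>rcoset_eqI\<close> with
      \<open>t\<close> the class of \<open>W\<close>.\<close>
    have "?g X \<otimes>\<^bsub>K\<^esub> ?g Z \<otimes>\<^bsub>K\<^esub> ?g W = ?g PX \<otimes>\<^bsub>K\<^esub> ?g PZ"
      using gc by (simp add: g_sum[OF X'(3)] g_sum[OF Z'(3)] g_sum[OF W] K.m_ac)
    then have XZ: "?g X \<otimes>\<^bsub>K\<^esub> ?g Z \<otimes>\<^bsub>K\<^esub> ?g W \<in> H"
      using g_mem X' Z' PO by simp
    have Y: "?g Y \<otimes>\<^bsub>K\<^esub> ?g W \<in> H" using g_mem[OF PYD PO(2)] g_sum[OF PY] by simp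
    have "H #>\<^bsub>K\<^esub> ?g Y = H #>\<^bsub>K\<^esub> (?g X \<otimes>\<^bsub>K\<^esub> ?g Z)"
      using gc by (intro K.rcoset_eqI[OF sub _ _ gc(6) Y XZ]) auto
    then show "H #>\<^bsub>K\<^esub> ?g Y = (H #>\<^bsub>K\<^esub> ?g X) \<otimes>\<^bsub>K Mod H\<^esub> (H #>\<^bsub>K\<^esub> ?g Z)"
      using gc by (simp add: FactGroup_def H.rcos_sum)
  qed
qed

text \<open>The map to cosets of \<open>H\<close> factors through the Grothendieck monoid, so
  \<open>A\<close> and \<open>B\<close> have the same coset. That of \<open>A\<close> is
  \<open>H\<close>, which puts the class of \<open>B\<close> into \<open>H\<close> and hence
  \<open>B\<close> into \<open>\<D>\<close>.\<close>

lemma dense_2of3_groth_class_invariant: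
  assumes D: "\<D> \<in> dense_2of3_subcats \<C>" and AB: "A \<in> \<D>" "B \<in> Obj \<C>"
    and eq: "groth_class \<C> (iso_class \<C> A) = groth_class \<C> (iso_class \<C> B)"
  shows "B \<in> \<D>"
proof -
  interpret S: comm_monoid "iso_monoid \<C>" by (rule iso_monoid_comm_monoid)
  define K where "K = group_completion (iso_monoid \<C>)"
  define H where "H = gc_span (iso_monoid \<C>) (iso_class \<C> ` \<D>)"
  interpret K: comm_group K unfolding K_def by (rule S.group_completion_comm_group)
  note css = dense_2of3_iso_monoid[OF D]
  have sub: "subgroup H K"
    using css S.gc_span_subgroup unfolding K_def H_def
    by (simp add: cofinal_subtractive_submonoids_def)
  have A: "A \<in> Obj \<C>" using dense_2of3D(1)[OF D] AB by blast
  have carr: "iso_class \<C> X \<in> carrier (iso_monoid \<C>)" if "X \<in> Obj \<C>" for X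
    using that by (simp add: iso_monoid_carrier)
  have g_carr: "gc_map (iso_monoid \<C>) (iso_class \<C> X) \<in> carrier K" if "X \<in> Obj \<C>" for X
    using S.gc_map_hom carr[OF that] by (auto simp: hom_def K_def)
  have cm: "comm_monoid (K Mod H)"
    using K.abelian_FactGroup[OF sub] by (rule comm_group.axioms)
  obtain h where h: "\<forall>U\<in>Iso \<C>. h (groth_class \<C> U) = H #>\<^bsub>K\<^esub> gc_map (iso_monoid \<C>) U"
    using groth_monoid_universal[OF cm respects_conflations_mod_dense[OF D, folded K_def H_def]]
    by (elim bexE conjE) (rule that)
  have "gc_map (iso_monoid \<C>) (iso_class \<C> A) \<in> H"
    unfolding H_def using S.gc_map_mem_span_iff[OF css carr[OF A]] AB(1) by blast
  then have "H #>\<^bsub>K\<^esub> gc_map (iso_monoid \<C>) (iso_class \<C> A) = H"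
    using K.coset_join2[OF g_carr[OF A] sub] by blast
  moreover have "H #>\<^bsub>K\<^esub> gc_map (iso_monoid \<C>) (iso_class \<C> B) =
      H #>\<^bsub>K\<^esub> gc_map (iso_monoid \<C>) (iso_class \<C> A)"
    unfolding bspec[OF h iso_class_Iso[OF A], symmetric] bspec[OF h iso_class_Iso[OF AB(2)], symmetric]
      eq ..
  ultimately have "gc_map (iso_monoid \<C>) (iso_class \<C> B) \<in> H"
    using K.rcos_self[OF g_carr[OF AB(2)] sub] by simp
  then show ?thesis
    using S.gc_map_mem_span_iff[OF css carr[OF AB(2)]] dense_2of3_mem_iso_class[OF D AB(2)]
    unfolding H_def by blast
qed

text \<open>The inverse sends \<open>S\<close> to the objects whose class lies in \<open>S\<close>.
  One composite is the identity by invariance of \<open>\<D>\<close> under equality of classes, the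
  other because every element of the monoid is the class of an object.\<close>

theorem dense_2of3_subcats_bij:
  "bij_betw (\<lambda>\<D>. (\<lambda>A. groth_class \<C> (iso_class \<C> A)) ` \<D>) (dense_2of3_subcats \<C>)
     (cofinal_subtractive_submonoids (groth_monoid \<C>))"
proof (rule bij_betw_byWitness[where f' = "\<lambda>S. {A \<in> Obj \<C>. groth_class \<C> (iso_class \<C> A) \<in> S}"])
  interpret M: comm_monoid "groth_monoid \<C>" by (rule groth_monoid_comm_monoid)
  let ?c = "\<lambda>A. groth_class \<C> (iso_class \<C> A)"
  have mem: "?c A \<in> ?c ` \<D> \<longleftrightarrow> A \<in> \<D>" if "\<D> \<in> dense_2of3_subcats \<C>" "A \<in> Obj \<C>" for \<D> A
    using that dense_2of3_groth_class_invariant by fastforce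
  show "\<forall>\<D>\<in>dense_2of3_subcats \<C>. {A \<in> Obj \<C>. ?c A \<in> ?c ` \<D>} = \<D>"
    using mem dense_2of3D(1) by blast
  show "\<forall>S\<in>cofinal_subtractive_submonoids (groth_monoid \<C>). ?c ` {A \<in> Obj \<C>. ?c A \<in> S} = S"
  proof (intro ballI subset_antisym subsetI)
    fix S W assume "S \<in> cofinal_subtractive_submonoids (groth_monoid \<C>)" and W: "W \<in> S"
    then have "W \<in> carrier (groth_monoid \<C>)"
      by (auto simp: cofinal_subtractive_submonoids_def dest: submonoid.mem_carrier)
    then show "W \<in> ?c ` {A \<in> Obj \<C>. ?c A \<in> S}" using W by (auto elim: groth_class_surj)
  qed auto
  show "(\<lambda>\<D>. ?c ` \<D>) ` dense_2of3_subcats \<C> \<subseteq> cofinal_subtractive_submonoids (groth_monoid \<C>)"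
  proof (rule image_subsetI)
    fix \<D> assume \<D>: "\<D> \<in> dense_2of3_subcats \<C>"
    note D = dense_2of3D(1,4)[OF \<D>] and dense = dense_2of3D(5)[OF \<D>]
    obtain Z where Z: "Z \<in> \<D>" "zero_object \<C> Z" using dense_2of3D(3)[OF \<D>] by blast
    have "submonoid (?c ` \<D>) (groth_monoid \<C>)"
    proof
      show "?c ` \<D> \<subseteq> carrier (groth_monoid \<C>)" using D groth_class_carrier by auto
      show "\<one>\<^bsub>groth_monoid \<C>\<^esub> \<in> ?c ` \<D>" using Z by (metis groth_class_zero image_eqI)
      fix U V assume "U \<in> ?c ` \<D>" "V \<in> ?c ` \<D>"
      then obtain A B where AB: "A \<in> \<D>" "U = ?c A" "B \<in> \<D>" "V = ?c B" by blast
      then obtain P where P: "direct_sum \<C> A B P" using ex_direct_sum D by blast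
      then show "U \<otimes>\<^bsub>groth_monoid \<C>\<^esub> V \<in> ?c ` \<D>"
        using AB D(2)[OF AB(1,3) P] by (simp add: groth_class_direct_sum[OF P, symmetric])
    qed
    moreover have "subtractive (groth_monoid \<C>) (?c ` \<D>)"
      unfolding subtractive_def
    proof (intro ballI impI)
      fix U V assume UV: "U \<in> carrier (groth_monoid \<C>)" "V \<in> carrier (groth_monoid \<C>)"
        "U \<otimes>\<^bsub>groth_monoid \<C>\<^esub> V \<in> ?c ` \<D> \<and> U \<in> ?c ` \<D>"
      obtain A where A: "A \<in> Obj \<C>" "U = ?c A" using UV(1) by (rule groth_class_surj)
      obtain B where B: "B \<in> Obj \<C>" "V = ?c B" using UV(2) by (rule groth_class_surj)
      obtain P where P: "direct_sum \<C> A B P" using ex_direct_sum A B by blast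
      then have "P \<in> Obj \<C>" using direct_sum_Obj by blast
      moreover have "?c P \<in> ?c ` \<D>" "?c A \<in> ?c ` \<D>"
        using UV(3) A B by (simp_all add: groth_class_direct_sum[OF P])
      \<comment> \<open>So far only the classes of \<open>P\<close> and \<open>A\<close> are known
        to come from \<open>\<D>\<close>; invariance places the objects themselves in it, so that
        cancellation applies.\<close>
      ultimately have "P \<in> \<D>" "A \<in> \<D>" using mem[OF \<D>] A by blast+
      then show "V \<in> ?c ` \<D>" using dense_2of3_cancel[OF \<D> P] B by simp
    qed
    moreover have "cofinal (groth_monoid \<C>) (?c ` \<D>)"
      unfolding cofinal_def
    proof
      fix U assume "U \<in> carrier (groth_monoid \<C>)"
      then obtain A where A: "A \<in> Obj \<C>" "U = ?c A" by (rule groth_class_surj)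
      then obtain A' P where P: "A' \<in> Obj \<C>" "P \<in> \<D>" "direct_sum \<C> A A' P" using dense by blast
      then show "\<exists>V\<in>carrier (groth_monoid \<C>). U \<otimes>\<^bsub>groth_monoid \<C>\<^esub> V \<in> ?c ` \<D>"
        using A groth_class_carrier[OF P(1)]
        by (intro bexI[of _ "?c A'"]) (simp_all add: groth_class_direct_sum[OF P(3), symmetric])
    qed
    ultimately show "?c ` \<D> \<in> cofinal_subtractive_submonoids (groth_monoid \<C>)"
      by (simp add: cofinal_subtractive_submonoids_def)
  qed
  show "(\<lambda>S. {A \<in> Obj \<C>. ?c A \<in> S}) ` cofinal_subtractive_submonoids (groth_monoid \<C>)
      \<subseteq> dense_2of3_subcats \<C>"
  proof (rule image_subsetI)
    fix S assume S: "S \<in> cofinal_subtractive_submonoids (groth_monoid \<C>)"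
    have sub: "submonoid S (groth_monoid \<C>)"
      using S unfolding cofinal_subtractive_submonoids_def by blast
    have subtr: "\<lbrakk>x \<in> carrier (groth_monoid \<C>); y \<in> carrier (groth_monoid \<C>);
        x \<otimes>\<^bsub>groth_monoid \<C>\<^esub> y \<in> S; x \<in> S\<rbrakk> \<Longrightarrow> y \<in> S" for x y
      using S unfolding cofinal_subtractive_submonoids_def subtractive_def by blast
    have cof: "\<exists>y\<in>carrier (groth_monoid \<C>). x \<otimes>\<^bsub>groth_monoid \<C>\<^esub> y \<in> S"
      if "x \<in> carrier (groth_monoid \<C>)" for x
      using S that unfolding cofinal_subtractive_submonoids_def cofinal_def by blast
    interpret S: submonoid S "groth_monoid \<C>" by (rule sub)
    let ?D = "{A \<in> Obj \<C>. ?c A \<in> S}"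
    obtain Z where Z: "zero_object \<C> Z" using ex_zero_object by blast
    have "Z \<in> ?D" using Z S.one_closed by (simp add: groth_class_zero[OF Z]) (simp add: zero_object_def)
    moreover have "B \<in> ?D" if "A \<in> ?D" "B \<in> Obj \<C>" "iso_arr \<C> A B f" for A B f
      using that iso_class_eqI[of A B f] by simp
    moreover have "P \<in> ?D" if "A \<in> ?D" "B \<in> ?D" "direct_sum \<C> A B P" for A B P
      using that direct_sum_Obj[OF that(3)] by (simp add: groth_class_direct_sum[OF that(3)])
    ultimately have "additive_subcat \<C> ?D"
      unfolding additive_subcat_def using Z by blast
    moreover have "dense_subcat \<C> ?D"
      unfolding dense_subcat_def
    proof
      fix A assume A: "A \<in> Obj \<C>"
      obtain V where V: "V \<in> carrier (groth_monoid \<C>)" "?c A \<otimes>\<^bsub>groth_monoid \<C>\<^esub> V \<in> S"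
        using cof[OF groth_class_carrier[OF A]] by blast
      \<comment> \<open>The complement supplied by cofinality is realized by an object, which turns
        it into a complementary summand of \<open>A\<close>.\<close>
      obtain A' where A': "A' \<in> Obj \<C>" "V = ?c A'" using V(1) by (rule groth_class_surj)
      obtain P where P: "direct_sum \<C> A A' P" using ex_direct_sum A A' by blast
      have "P \<in> ?D" using V A' direct_sum_Obj[OF P] by (simp add: groth_class_direct_sum[OF P])
      then show "\<exists>A'\<in>Obj \<C>. \<exists>P\<in>?D. direct_sum \<C> A A' P" using P A' by blast
    qed
    moreover have "two_out_of_three \<C> ?D"
      unfolding two_out_of_three_def
    proof (intro allI impI)
      fix X x Y y Z \<delta> assume c: "conflation \<C> X x Y y Z \<delta>"
      note o = conflation_Obj[OF c]
      note gc = groth_class_carrier[OF o(1)] groth_class_carrier[OF o(3)]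
      \<comment> \<open>Subtractivity cancels the left summand; the two orders let it remove either
        end term of the conflation.\<close>
      have e: "?c Y = ?c X \<otimes>\<^bsub>groth_monoid \<C>\<^esub> ?c Z" "?c Y = ?c Z \<otimes>\<^bsub>groth_monoid \<C>\<^esub> ?c X"
        using groth_class_mult[OF c] gc by (simp_all add: M.m_comm)
      show "(X \<in> ?D \<and> Y \<in> ?D \<longrightarrow> Z \<in> ?D) \<and> (X \<in> ?D \<and> Z \<in> ?D \<longrightarrow> Y \<in> ?D) \<and>
          (Y \<in> ?D \<and> Z \<in> ?D \<longrightarrow> X \<in> ?D)"
        using o subtr[OF gc] subtr[OF gc(2,1)] S.m_closed e by (metis (mono_tags) mem_Collect_eq)
    qed
    ultimately show "?D \<in> dense_2of3_subcats \<C>" by (simp add: dense_2of3_subcats_def)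
  qed
qed

end

theorem theorem2:
  fixes \<C> :: "('o, 'm, 'e, 'z) extri_scheme"
  assumes "extriangulated_category \<C>"
  shows "(\<exists>\<phi>. bij_betw \<phi> (dense_2of3_subcats \<C>)
                (cofinal_subtractive_submonoids (groth_monoid \<C>))) \<and>
         (\<exists>\<psi>. bij_betw \<psi> (cofinal_subtractive_submonoids (groth_monoid \<C>))
                (cofinal_K0_subgroups \<C>))"
proof -
  interpret extriangulated_category \<C> by fact
  interpret M: comm_monoid "groth_monoid \<C>" by (rule groth_monoid_comm_monoid)
  \<comment> \<open>The Grothendieck group is the group completion of the Grothendieck monoid and
    \<open>groth_rho\<close> its canonical map, so the bijection between (2) and (3) is the general
    one for commutative monoids.\<close>
  have "bij_betw (gc_span (groth_monoid \<C>)) (cofinal_subtractive_submonoids (groth_monoid \<C>))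
      (cofinal_K0_subgroups \<C>)"
    using M.cofinal_subtractive_bij_subgroups
    by (simp add: cofinal_K0_subgroups_def groth_group_def rho_preimage_def groth_rho_def)
  then show ?thesis using dense_2of3_subcats_bij by blast
qed

end
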